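(* Let $H$ and $K$ be subgroups of rank $3$ of a free group. If $\operatorname{rank}(H\cap K)\ge 3$, then $\operatorname{rank}(H\vee K)\le 3$.
   Context: The rank of a finitely generated group is the minimal cardinality of a generating set. For subgroups $H,K$ of a group, $H\vee K=\langle H,K\rangle$ denotes the subgroup generated by $H\cup K$ (the join). *)

theory Defs
  imports "HOL-Algebra.Generated_Groups" "HOL-Library.Extended_Nat"
begin

(* A letter (s, True) stands for the generator s and (s, False) for its inverse.
   Words are formal: whether a word is reduced does not depend on the group. *)
type_synonym 'a word = "('a \<times> bool) list"

definition reduced_words :: "'a set \<Rightarrow> 'a word set" where
  "reduced_words S =
     {w. fst ` set w \<subseteq> S \<and>
         successively (\<lambda>x y. \<not> (fst x = fst y \<and> snd x \<noteq> snd y)) w}"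

definition letter_value :: "('a, 'b) monoid_scheme \<Rightarrow> 'a \<times> bool \<Rightarrow> 'a" where
  "letter_value G x = (if snd x then fst x else inv\<^bsub>G\<^esub> (fst x))"

definition word_value :: "('a, 'b) monoid_scheme \<Rightarrow> 'a word \<Rightarrow> 'a" where
  "word_value G w = foldr (\<lambda>x g. letter_value G x \<otimes>\<^bsub>G\<^esub> g) w \<one>\<^bsub>G\<^esub>"

(* S is a free basis of G when every element of G is the value of exactly one
   reduced word over S. *)
definition free_basis :: "('a, 'b) monoid_scheme \<Rightarrow> 'a set \<Rightarrow> bool" where
  "free_basis G S \<longleftrightarrow>
     S \<subseteq> carrier G \<and> bij_betw (word_value G) (reduced_words S) (carrier G)"

definition free_group :: "('a, 'b) monoid_scheme \<Rightarrow> bool" where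
  "free_group G \<longleftrightarrow> group G \<and> (\<exists>S. free_basis G S)"

(* The infimum of the empty set is \<infinity>, so the rank is finite exactly
   for finitely generated groups, and for those it is a minimum. *)
definition group_rank :: "('a, 'b) monoid_scheme \<Rightarrow> enat" where
  "group_rank G =
     Inf {enat (card S) |S. finite S \<and> S \<subseteq> carrier G \<and> generate G S = carrier G}"

(* A subgroup of G is given by its carrier; its rank is that of the group it forms. *)
abbreviation subgroup_rank :: "('a, 'b) monoid_scheme \<Rightarrow> 'a set \<Rightarrow> enat" where
  "subgroup_rank G H \<equiv> group_rank (G\<lparr>carrier := H\<rparr>)"

definition subgroup_join :: "('a, 'b) monoid_scheme \<Rightarrow> 'a set \<Rightarrow> 'a set \<Rightarrow> 'a set" where
  "subgroup_join G H K = generate G (H \<union> K)"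

end

theory Submission
  imports Defs
begin

text \<open>The proof compares core graphs and counts homomorphisms to \<open>\<int>/2\<close>. Every subgroup \<open>H\<close> of a free group has
a core graph: the quotient by \<open>H\<close> of the union of the paths from \<open>1\<close> to the elements of \<open>H\<close> in the
Cayley tree. Suppose that it is finite, with \<open>V\<close> vertices and \<open>E\<close> edges. A spanning tree exhibits \<open>E - V + 1\<close> generators
of \<open>H\<close> (\<open>generators_of_core\<close>), and a cochain on the edges lifts to a potential on the tree, so that
\<open>H\<close> has at least \<open>2\<^sup>E / 2\<^bsup>V-1\<^esup>\<close> homomorphisms to \<open>\<int>/2\<close> (\<open>card_edges_le_mod2_homs\<close>); a group with
\<open>r\<close> generators has at most \<open>2\<^sup>r\<close> of them. Hence \<open>E - V \<le> 2\<close> when three elements generate \<open>H\<close>, and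
\<open>E - V \<ge> 2\<close> when no two elements generate it. After a conjugation the base point lies on the axis of an
element of \<open>H \<inter> K\<close>, all vertices of the core graphs of \<open>H\<close>, \<open>K\<close> and \<open>H \<inter> K\<close> have at least two directions,
and \<open>2 * (E - V)\<close> counts the branchings: the pairs of a vertex and a direction there that is neither
the first nor the last one in a fixed order. So \<open>H\<close> and \<open>K\<close> have at most four branchings each, and
\<open>H \<inter> K\<close> has at least four.

Now glue the core graphs of \<open>H\<close> and \<open>K\<close> along the core graph of \<open>H \<inter> K\<close>, which maps to both. The
fundamental group of the result surjects onto the join \<open>L\<close> of \<open>H\<close> and \<open>K\<close>, so the homomorphisms from
\<open>L\<close> to \<open>\<int>/2\<close> are bounded by the cochains of the glued graph modulo coboundaries
(\<open>card_mod2_homs_join\<close>). If the directions at each vertex are spread along a path, the glued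
graph becomes trivalent with branch points the classes of branchings, and minus twice its Euler
characteristic is at most the number \<open>I\<close> of these classes; \<open>card_legs_le\<close> is this inequality, stated for
numbers of functions to \<open>\<int>/2\<close>. A branching of \<open>H \<inter> K\<close> identifies a branching of \<open>H\<close> with one of \<open>K\<close>, and
different branchings give different pairs. A bipartite graph with four edges contains a forest
with three edges, so \<open>I \<le> 8 - 3 = 5\<close> (\<open>card_invariant_sets_bipartite\<close>). If \<open>h\<close> is the number of
homomorphisms from \<open>L\<close> to \<open>\<int>/2\<close>, this gives \<open>h\<^sup>2 \<le> 4 * 2\<^sup>5 = 2\<^sup>7\<close>. The core graph of \<open>L\<close> yields \<open>r\<close>
generators of \<open>L\<close> with \<open>2\<^sup>r \<le> h\<close>, so \<open>2 * r \<le> 7\<close> and \<open>r \<le> 3\<close>.\<close>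

section \<open>Families of sets that are invariant under links\<close>

text \<open>These sets are the functions from \<open>A\<close> to \<open>\<int>/2\<close> that are constant on the components of the graph
with vertex set \<open>A\<close> and edge set \<open>R\<close>. Their number is two to the number of components; working with it
turns counts of components into injections between families of sets.\<close>

definition invariant_sets :: "'z set \<Rightarrow> ('z \<times> 'z) set \<Rightarrow> 'z set set" where
  "invariant_sets A R = {f. f \<subseteq> A \<and> (\<forall>(x, y)\<in>R. x \<in> f \<longleftrightarrow> y \<in> f)}"

definition lift_links :: "('z \<times> 'z) set \<Rightarrow> ('z \<Rightarrow> 'z \<Rightarrow> 'd set) \<Rightarrow> (('z \<times> 'd) \<times> ('z \<times> 'd)) set" where
  "lift_links \<Lambda> E = {((x, d), (y, d)) | x y d. (x, y) \<in> \<Lambda> \<and> d \<in> E x y}"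

text \<open>Spread the elements of \<open>D\<close> along a line, with one leg at each of them. In the part of the line between
the first and the last leg, the inner elements are the branch points.\<close>

definition inner :: "nat set \<Rightarrow> nat set" where
  "inner D = D - {Min D, Max D}"

lemma invariant_setsD:
  assumes "f \<in> invariant_sets A R"
  shows "f \<subseteq> A" and "(x, y) \<in> R \<Longrightarrow> x \<in> f \<longleftrightarrow> y \<in> f"
  using assms by (auto simp: invariant_sets_def)

lemma lift_linksI: "(x, y) \<in> \<Lambda> \<Longrightarrow> d \<in> E x y \<Longrightarrow> ((x, d), (y, d)) \<in> lift_links \<Lambda> E"
  unfolding lift_links_def by blast

lemma invariant_sets_liftI:
  assumes "f \<subseteq> A" and "\<And>x y d. (x, y) \<in> \<Lambda> \<Longrightarrow> d \<in> E x y \<Longrightarrow> (x, d) \<in> f \<longleftrightarrow> (y, d) \<in> f"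
  shows "f \<in> invariant_sets A (lift_links \<Lambda> E)"
  unfolding invariant_sets_def lift_links_def using assms by blast

lemma finite_invariant_sets [simp]: "finite A \<Longrightarrow> finite (invariant_sets A R)"
  unfolding invariant_sets_def by (rule finite_subset[of _ "Pow A"]) auto

lemma card_invariant_sets_pos:
  assumes "finite A"
  shows "0 < card (invariant_sets A R)"
proof -
  have "{} \<in> invariant_sets A R" by (auto simp: invariant_sets_def)
  then show ?thesis using assms by (auto simp: card_gt_0_iff)
qed

lemma card_invariant_sets_image:
  assumes "inj_on g A" and "R \<subseteq> A \<times> A"
  shows "card (invariant_sets (g ` A) (map_prod g g ` R)) = card (invariant_sets A R)"
proof -
  have "bij_betw (image g) (invariant_sets A R) (invariant_sets (g ` A) (map_prod g g ` R))"
    unfolding bij_betw_def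
  proof
    show "inj_on (image g) (invariant_sets A R)"
      by (rule inj_on_subset[OF inj_on_image_Pow[OF assms(1)]]) (auto simp: invariant_sets_def)
    show "image g ` invariant_sets A R = invariant_sets (g ` A) (map_prod g g ` R)"
    proof (intro equalityI subsetI)
      fix f assume "f \<in> image g ` invariant_sets A R"
      then obtain f0 where f0: "f0 \<in> invariant_sets A R" "f = g ` f0" by auto
      have mem: "g x \<in> f \<longleftrightarrow> x \<in> f0" if "x \<in> A" for x
        using inj_on_image_mem_iff[OF assms(1) that invariant_setsD(1)[OF f0(1)]] f0(2) by simp
      have "x \<in> f \<longleftrightarrow> y \<in> f" if xy: "(x, y) \<in> map_prod g g ` R" for x y
      proof -
        obtain a b where ab: "(a, b) \<in> R" "x = g a" "y = g b" using xy by auto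
        then have "a \<in> A" "b \<in> A" using assms(2) by auto
        then show ?thesis using mem ab invariant_setsD(2)[OF f0(1) ab(1)] by simp
      qed
      moreover have "f \<subseteq> g ` A" using f0(2) invariant_setsD(1)[OF f0(1)] by auto
      ultimately show "f \<in> invariant_sets (g ` A) (map_prod g g ` R)"
        unfolding invariant_sets_def by blast
    next
      fix f assume f: "f \<in> invariant_sets (g ` A) (map_prod g g ` R)"
      define f0 where "f0 = {x \<in> A. g x \<in> f}"
      have "x \<in> f0 \<longleftrightarrow> y \<in> f0" if "(x, y) \<in> R" for x y
      proof -
        have "(g x, g y) \<in> map_prod g g ` R" using that by force
        then have "g x \<in> f \<longleftrightarrow> g y \<in> f" by (rule invariant_setsD(2)[OF f])
        then show ?thesis using that assms(2) by (auto simp: f0_def)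
      qed
      then have "f0 \<in> invariant_sets A R" by (auto simp: invariant_sets_def f0_def)
      moreover have "f = g ` f0" using invariant_setsD(1)[OF f] by (auto simp: f0_def)
      ultimately show "f \<in> image g ` invariant_sets A R" by blast
    qed
  qed
  then show ?thesis by (metis bij_betw_same_card)
qed

text \<open>This plays the part of the dimension formula for a linear map over \<open>\<int>/2\<close>.\<close>

lemma card_le_card_mult_fibre:
  assumes "finite X" and "finite Y" and "\<theta> ` X \<subseteq> Y"
    and fibre: "\<And>x. x \<in> X \<Longrightarrow> card {x' \<in> X. \<theta> x' = \<theta> x} \<le> k"
  shows "card X \<le> k * card Y"
proof -
  have "X = (\<Union>y\<in>Y. {x' \<in> X. \<theta> x' = y})" using assms(3) by auto
  then have "card X \<le> (\<Sum>y\<in>Y. card {x' \<in> X. \<theta> x' = y})"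
    using card_UN_le[OF assms(2), of "\<lambda>y. {x' \<in> X. \<theta> x' = y}"] by simp
  also have "\<dots> \<le> (\<Sum>y\<in>Y. k)"
  proof (rule sum_mono)
    fix y assume "y \<in> Y"
    show "card {x' \<in> X. \<theta> x' = y} \<le> k"
    proof (cases "\<exists>x\<in>X. \<theta> x = y")
      case True
      then show ?thesis using fibre by auto
    next
      case False
      then have "{x' \<in> X. \<theta> x' = y} = {}" by auto
      then show ?thesis by (metis card.empty le0)
    qed
  qed
  finally show ?thesis by (simp add: mult.commute)
qed

text \<open>The link determines membership of \<open>n\<close> from membership of \<open>a\<close>.\<close>

lemma card_invariant_sets_link:
  assumes "finite A" and "a \<in> A" and "n \<noteq> a" and "(n, a) \<in> R \<or> (a, n) \<in> R"
  shows "card (invariant_sets A R) \<le> card (invariant_sets (A - {n}) {(x, y) \<in> R. x \<noteq> n \<and> y \<noteq> n})"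
proof (rule card_inj_on_le)
  show "finite (invariant_sets (A - {n}) {(x, y) \<in> R. x \<noteq> n \<and> y \<noteq> n})" using assms(1) by simp
  show "(\<lambda>f. f - {n}) ` invariant_sets A R \<subseteq> invariant_sets (A - {n}) {(x, y) \<in> R. x \<noteq> n \<and> y \<noteq> n}"
    by (auto simp: invariant_sets_def split: prod.splits)
  show "inj_on (\<lambda>f. f - {n}) (invariant_sets A R)"
  proof (rule inj_onI)
    fix f g assume f: "f \<in> invariant_sets A R" and g: "g \<in> invariant_sets A R" and eq: "f - {n} = g - {n}"
    have "n \<in> f \<longleftrightarrow> a \<in> f" "n \<in> g \<longleftrightarrow> a \<in> g"
      using assms(4) invariant_setsD(2)[OF f, of n a] invariant_setsD(2)[OF f, of a n]
        invariant_setsD(2)[OF g, of n a] invariant_setsD(2)[OF g, of a n] by auto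
    moreover have "a \<in> f \<longleftrightarrow> a \<in> g" using eq assms(3) by blast
    ultimately show "f = g" using eq by blast
  qed
qed

lemma Min_less_Max: "finite A \<Longrightarrow> 2 \<le> card A \<Longrightarrow> Min A < Max (A :: nat set)"
proof -
  assume A: "finite A" "2 \<le> card A"
  have "\<not> Max A \<le> Min A"
  proof
    assume "Max A \<le> Min A"
    then have "a = Min A" if "a \<in> A" for a
      using Min_le[OF A(1) that] Max_ge[OF A(1) that] by linarith
    then have "A \<subseteq> {Min A}" by blast
    then have "card A \<le> 1" using card_mono[of "{Min A}" A] by simp
    then show False using A by simp
  qed
  then show ?thesis by simp
qed

lemma card_inner: "finite X \<Longrightarrow> 2 \<le> card X \<Longrightarrow> card (inner X) + 2 = card X"
proof -
  assume X: "finite X" "2 \<le> card X"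
  then have "X \<noteq> {}" by auto
  then have "{Min X, Max X} \<subseteq> X" using X(1) by simp
  then have "card (inner X) = card X - card {Min X, Max X}"
    unfolding inner_def by (intro card_Diff_subset) simp_all
  then show ?thesis using Min_less_Max[OF X] X by simp
qed

section \<open>An Euler characteristic inequality for glued nodes\<close>

text \<open>Each node \<open>z\<close> carries finitely many legs \<open>D z\<close>, coded by natural numbers, and is expanded to a spine: the
path on the interval from its least to its greatest leg. A link between \<open>x\<close> and \<open>y\<close> glues the legs in \<open>E x y\<close>
and the part of the two spines between them. All vertices of the expanded nodes have degree at most three.\<close>

locale link_system =
  fixes Z :: "'z set" and \<Lambda> :: "('z \<times> 'z) set"
    and D :: "'z \<Rightarrow> nat set" and E :: "'z \<Rightarrow> 'z \<Rightarrow> nat set"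
  assumes finite_Z: "finite Z"
    and finite_D: "z \<in> Z \<Longrightarrow> finite (D z)"
    and links: "\<Lambda> \<subseteq> Z \<times> Z"
    and E_subset: "(x, y) \<in> \<Lambda> \<Longrightarrow> E x y \<subseteq> D x \<inter> D y"
    and card_D: "z \<in> Z \<Longrightarrow> 2 \<le> card (D z)"
    and card_E: "(x, y) \<in> \<Lambda> \<Longrightarrow> 2 \<le> card (E x y)"
begin

abbreviation "lo z \<equiv> Min (D z)"
abbreviation "hi z \<equiv> Max (D z)"

abbreviation "legs \<equiv> invariant_sets (Sigma Z D) (lift_links \<Lambda> E)"
abbreviation "inner_legs \<equiv>
  invariant_sets (Sigma Z (\<lambda>z. inner (D z))) (lift_links \<Lambda> (\<lambda>x y. inner (E x y)))"
abbreviation "spine_vertices \<equiv> invariant_sets (Sigma Z (\<lambda>z. {lo z..hi z}))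
  (lift_links \<Lambda> (\<lambda>x y. {Min (E x y)..Max (E x y)}))"
abbreviation "spine_edges \<equiv> invariant_sets (Sigma Z (\<lambda>z. {lo z..<hi z}))
  (lift_links \<Lambda> (\<lambda>x y. {Min (E x y)..<Max (E x y)}))"

lemma lo_less_hi: "z \<in> Z \<Longrightarrow> lo z < hi z"
  using Min_less_Max finite_D card_D by auto

lemma link:
  assumes "(x, y) \<in> \<Lambda>"
  shows "x \<in> Z" "y \<in> Z" "finite (E x y)" "Min (E x y) \<in> E x y" "Max (E x y) \<in> E x y"
    "Min (E x y) < Max (E x y)" "lo x \<le> Min (E x y)" "lo y \<le> Min (E x y)"
    "Max (E x y) \<le> hi x" "Max (E x y) \<le> hi y" "E x y \<subseteq> D x" "E x y \<subseteq> D y"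
proof -
  show xy: "x \<in> Z" "y \<in> Z" "E x y \<subseteq> D x" "E x y \<subseteq> D y" using assms links E_subset by auto
  show fin: "finite (E x y)" using xy finite_D finite_subset by blast
  have ne: "E x y \<noteq> {}" using card_E[OF assms] by auto
  show mm: "Min (E x y) \<in> E x y" "Max (E x y) \<in> E x y" using fin ne by auto
  show "Min (E x y) < Max (E x y)" using Min_less_Max fin card_E assms by auto
  show "lo x \<le> Min (E x y)" "lo y \<le> Min (E x y)" "Max (E x y) \<le> hi x" "Max (E x y) \<le> hi y"
    using mm xy finite_D by (meson Min_le Max_ge subsetD)+
qed

lemma inner_bounds:
  assumes "(x, y) \<in> \<Lambda>" and "i \<in> inner (E x y)"
  shows "i \<in> E x y" "Min (E x y) < i" "i < Max (E x y)"
proof -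
  show i: "i \<in> E x y" using assms(2) by (simp add: inner_def)
  have "Min (E x y) \<le> i" "i \<le> Max (E x y)" using i link(3)[OF assms(1)] by simp_all
  then show "Min (E x y) < i" "i < Max (E x y)"
    using assms(2) by (auto simp: inner_def)
qed

lemma inner_E: "(x, y) \<in> \<Lambda> \<Longrightarrow> i \<in> inner (E x y) \<Longrightarrow> i \<in> inner (D x) \<and> i \<in> inner (D y)"
proof -
  assume e: "(x, y) \<in> \<Lambda>" and i: "i \<in> inner (E x y)"
  note l = link[OF e]
  show ?thesis using l inner_bounds[OF e i] by (auto simp: inner_def)
qed

text \<open>The coboundary maps functions on spine vertices to functions on spine edges. Two functions with the
same coboundary differ by a function that is constant along each spine, hence by a function on nodes.\<close>

lemma card_spine_vertices_le:
  "card spine_vertices \<le> card (invariant_sets Z \<Lambda>) * card spine_edges"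
proof (rule card_le_card_mult_fibre[where
      \<theta> = "\<lambda>g. {(z, i) \<in> Sigma Z (\<lambda>z. {lo z..<hi z}). ((z, i) \<in> g) \<noteq> ((z, Suc i) \<in> g)}"])
  show "finite spine_vertices" "finite spine_edges" using finite_Z by auto
  let ?\<theta> = "\<lambda>g. {(z, i) \<in> Sigma Z (\<lambda>z. {lo z..<hi z}). ((z, i) \<in> g) \<noteq> ((z, Suc i) \<in> g)}"
  show "?\<theta> ` spine_vertices \<subseteq> spine_edges"
  proof (intro image_subsetI)
    fix g assume g: "g \<in> spine_vertices"
    have "((x, i) \<in> ?\<theta> g) = ((y, i) \<in> ?\<theta> g)"
      if e: "(x, y) \<in> \<Lambda>" and i: "i \<in> {Min (E x y)..<Max (E x y)}" for x y i
    proof -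
      have "((x, j) \<in> g) = ((y, j) \<in> g)" if "j \<in> {Min (E x y)..Max (E x y)}" for j
        using g e that by (intro invariant_setsD(2)[OF g]) (auto simp: lift_links_def)
      then have "((x, i) \<in> g) = ((y, i) \<in> g)" "((x, Suc i) \<in> g) = ((y, Suc i) \<in> g)"
        using i by auto
      then show ?thesis using link[OF e] i by auto
    qed
    then show "?\<theta> g \<in> spine_edges"
      by (auto simp: invariant_sets_def lift_links_def)
  qed
  fix g assume g: "g \<in> spine_vertices"
  let ?F = "{g' \<in> spine_vertices. ?\<theta> g' = ?\<theta> g}"
  let ?d = "\<lambda>g' z i. ((z, i) \<in> g') \<noteq> ((z, i) \<in> g)"
  let ?r = "\<lambda>g'. {z \<in> Z. ?d g' z (lo z)}"
  have const: "?d g' z i = ?d g' z (lo z)" if g': "g' \<in> ?F" and z: "z \<in> Z" and i: "i \<in> {lo z..hi z}" for g' z i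
  proof -
    have "lo z \<le> i" "i \<le> hi z" using i by auto
    then show ?thesis
    proof (induction rule: dec_induct)
      case base
      then show ?case by simp
    next
      case (step j)
      have "(z, j) \<in> ?\<theta> g' \<longleftrightarrow> (z, j) \<in> ?\<theta> g" using g' by auto
      then have "((z, j) \<in> g') \<noteq> ((z, Suc j) \<in> g') \<longleftrightarrow> ((z, j) \<in> g) \<noteq> ((z, Suc j) \<in> g)"
        using z step by simp
      then show ?case using step by auto
    qed
  qed
  have "card ?F \<le> card (invariant_sets Z \<Lambda>)"
  proof (rule card_inj_on_le)
    show "finite (invariant_sets Z \<Lambda>)" using finite_Z by simp
    show "?r ` ?F \<subseteq> invariant_sets Z \<Lambda>"
    proof (intro image_subsetI)
      fix g' assume g': "g' \<in> ?F"
      have "x \<in> ?r g' \<longleftrightarrow> y \<in> ?r g'" if e: "(x, y) \<in> \<Lambda>" for x y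
      proof -
        note l = link[OF e]
        let ?i = "Min (E x y)"
        have i: "((x, ?i), (y, ?i)) \<in> lift_links \<Lambda> (\<lambda>x y. {Min (E x y)..Max (E x y)})"
          using e l by (auto simp: lift_links_def)
        have "g' \<in> spine_vertices" using g' by blast
        then have "?d g' x ?i = ?d g' y ?i"
          using invariant_setsD(2)[OF g i] invariant_setsD(2)[OF _ i, of g'] by simp
        moreover have "?d g' x ?i = ?d g' x (lo x)" "?d g' y ?i = ?d g' y (lo y)"
          using l const[OF g', of x ?i] const[OF g', of y ?i] by simp_all
        ultimately show ?thesis using l by simp
      qed
      then show "?r g' \<in> invariant_sets Z \<Lambda>" by (auto simp: invariant_sets_def)
    qed
    show "inj_on ?r ?F"
    proof (rule inj_onI)
      fix a b assume a: "a \<in> ?F" and b: "b \<in> ?F" and eq: "?r a = ?r b"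
      have "(z, i) \<in> a \<longleftrightarrow> (z, i) \<in> b" if "z \<in> Z" "i \<in> {lo z..hi z}" for z i
      proof -
        have "?d a z (lo z) = ?d b z (lo z)" using eq that by blast
        then show ?thesis using const[OF a that] const[OF b that] by auto
      qed
      moreover have "a \<subseteq> Sigma Z (\<lambda>z. {lo z..hi z})" "b \<subseteq> Sigma Z (\<lambda>z. {lo z..hi z})"
        using a b invariant_setsD(1) by blast+
      ultimately show "a = b" by auto
    qed
  qed
  then show "card ?F \<le> card (invariant_sets Z \<Lambda>)" .
qed

text \<open>The triple \<open>(r, l, f)\<close> holds values at the right ends, the left ends and the legs; the edge from \<open>i\<close> to
\<open>i + 1\<close> is indexed by \<open>i\<close>, so the left end at \<open>i\<close> has index \<open>i - 1\<close>. Map a triple to the sum of its three values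
at each branch point. If two triples have the same image, their difference has sum zero at every branch
point, and at every other spine vertex one of the three ends is absent and can be given
the value that makes the sum zero. Then any two of the three values determine the third. Every spine
vertex of a link has at least two of the three ends in the link, so the completed values are invariant,
and the difference is recorded by two functions on spine vertices.\<close>

lemma card_legs_spine_le:
  "card (spine_edges \<times> spine_edges \<times> legs)
    \<le> card (spine_vertices \<times> spine_vertices) * card inner_legs"
proof (rule card_le_card_mult_fibre[where
      \<theta> = "\<lambda>(r, l, f). {(z, i) \<in> Sigma Z (\<lambda>z. inner (D z)).
             (((z, i) \<in> r) \<noteq> ((z, i - 1) \<in> l)) \<noteq> ((z, i) \<in> f)}"])
  let ?\<theta> = "\<lambda>(r, l, f). {(z, i) \<in> Sigma Z (\<lambda>z. inner (D z)).
             (((z, i) \<in> r) \<noteq> ((z, i - 1) \<in> l)) \<noteq> ((z, i) \<in> f)}"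
  let ?X = "spine_edges \<times> spine_edges \<times> legs"
  have fin_inner: "finite (Sigma Z (\<lambda>z. inner (D z)))"
    using finite_Z finite_D by (auto simp: inner_def)
  show "finite ?X" using finite_Z finite_D by simp
  show "finite inner_legs" using fin_inner by simp
  have edge_inv: "(x, i) \<in> s \<longleftrightarrow> (y, i) \<in> s"
    if "s \<in> spine_edges" "(x, y) \<in> \<Lambda>" "Min (E x y) \<le> i" "i < Max (E x y)" for s x y i
    using that by (intro invariant_setsD(2)[OF that(1)]) (auto simp: lift_links_def)
  have leg_inv: "(x, i) \<in> f \<longleftrightarrow> (y, i) \<in> f"
    if "f \<in> legs" "(x, y) \<in> \<Lambda>" "i \<in> E x y" for f x y i
    using that by (intro invariant_setsD(2)[OF that(1)]) (auto simp: lift_links_def)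
  show "?\<theta> ` ?X \<subseteq> inner_legs"
  proof (intro image_subsetI)
    fix t assume "t \<in> ?X"
    then obtain r l f where t: "t = (r, l, f)" and r: "r \<in> spine_edges" and l: "l \<in> spine_edges" and f: "f \<in> legs"
      by auto
    have "(x, i) \<in> ?\<theta> t \<longleftrightarrow> (y, i) \<in> ?\<theta> t" if e: "(x, y) \<in> \<Lambda>" and i: "i \<in> inner (E x y)" for x y i
    proof -
      note lk = link[OF e]
      note i' = inner_bounds[OF e i]
      then show ?thesis
        using edge_inv[OF r e, of i] edge_inv[OF l e, of "i - 1"] leg_inv[OF f e i'(1)]
          inner_E[OF e i] lk t by auto
    qed
    then show "?\<theta> t \<in> inner_legs" by (auto simp: invariant_sets_def lift_links_def)
  qed
  fix t assume "t \<in> ?X"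
  then obtain r l f where t: "t = (r, l, f)" and r: "r \<in> spine_edges" and l: "l \<in> spine_edges" and f: "f \<in> legs"
    by auto
  let ?F = "{t' \<in> ?X. ?\<theta> t' = ?\<theta> t}"
  let ?dr = "\<lambda>r' z i. ((z, i) \<in> r') \<noteq> ((z, i) \<in> r)"
  let ?dl = "\<lambda>l' z i. ((z, i - 1) \<in> l') \<noteq> ((z, i - 1) \<in> l)"
  let ?df = "\<lambda>f' z i. ((z, i) \<in> f') \<noteq> ((z, i) \<in> f)"
  \<comment> \<open>The right and the left values of the difference, completed where an end is absent.\<close>
  define p where "p = (\<lambda>(r', l', f'). {(z, i) \<in> Sigma Z (\<lambda>z. {lo z..hi z}).
     if i < hi z then ?dr r' z i else ?dl l' z i \<noteq> ?df f' z i})"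
  define q where "q = (\<lambda>(r', l', f'). {(z, i) \<in> Sigma Z (\<lambda>z. {lo z..hi z}).
     if lo z < i then ?dl l' z i else ?dr r' z i \<noteq> ?df f' z i})"
  have zero: "?df f' z i \<longleftrightarrow> ?dr r' z i \<noteq> ?dl l' z i"
    if "(r', l', f') \<in> ?F" "z \<in> Z" "i \<in> inner (D z)" for r' l' f' z i
  proof -
    have "(z, i) \<in> ?\<theta> (r', l', f') \<longleftrightarrow> (z, i) \<in> ?\<theta> t" using that by blast
    then show ?thesis using that t by auto
  qed
  have three: "(i < hi z \<longrightarrow> ?dr r' z i = ((z, i) \<in> p (r', l', f')))
      \<and> (lo z < i \<longrightarrow> ?dl l' z i = ((z, i) \<in> q (r', l', f')))
      \<and> (i \<in> D z \<longrightarrow> ?df f' z i = (((z, i) \<in> p (r', l', f')) \<noteq> ((z, i) \<in> q (r', l', f'))))"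
    if F: "(r', l', f') \<in> ?F" and z: "z \<in> Z" and i: "lo z \<le> i" "i \<le> hi z" for r' l' f' z i
  proof -
    have mem: "(z, i) \<in> p (r', l', f') \<longleftrightarrow> (if i < hi z then ?dr r' z i else ?dl l' z i \<noteq> ?df f' z i)"
      "(z, i) \<in> q (r', l', f') \<longleftrightarrow> (if lo z < i then ?dl l' z i else ?dr r' z i \<noteq> ?df f' z i)"
      using z i by (simp_all add: p_def q_def)
    consider "lo z < i" "i < hi z" | "i = lo z" "i < hi z" | "lo z < i" "i = hi z"
      using lo_less_hi[OF z] i by linarith
    then show ?thesis
    proof cases
      case 1
      have "?df f' z i \<longleftrightarrow> ?dr r' z i \<noteq> ?dl l' z i" if "i \<in> D z"
        using zero[OF F z] that 1 by (simp add: inner_def)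
      then show ?thesis using 1 mem by simp
    qed (use mem in auto)
  qed
  show "card ?F \<le> card (spine_vertices \<times> spine_vertices)"
  proof (rule card_inj_on_le)
    show "finite (spine_vertices \<times> spine_vertices)" using finite_Z by simp
    show "(\<lambda>t. (p t, q t)) ` ?F \<subseteq> spine_vertices \<times> spine_vertices"
    proof (intro image_subsetI)
      fix t' assume t': "t' \<in> ?F"
      then obtain r' l' f' where eq: "t' = (r', l', f')" and r': "r' \<in> spine_edges" and l': "l' \<in> spine_edges"
        and f': "f' \<in> legs" by auto
      note F = t'[unfolded eq]
      have inv: "((x, i) \<in> p t' \<longleftrightarrow> (y, i) \<in> p t') \<and> ((x, i) \<in> q t' \<longleftrightarrow> (y, i) \<in> q t')"
        if e: "(x, y) \<in> \<Lambda>" and i: "i \<in> {Min (E x y)..Max (E x y)}" for x y i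
      proof -
        note lk = link[OF e]
        have x: "lo x \<le> i" "i \<le> hi x" and y: "lo y \<le> i" "i \<le> hi y" using i lk by auto
        note tx = three[OF F lk(1) x] and ty = three[OF F lk(2) y]
        have dr: "?dr r' x i = ?dr r' y i" if "i < Max (E x y)"
          using edge_inv[OF r e _ that] edge_inv[OF r' e _ that] i by simp
        have dl: "?dl l' x i = ?dl l' y i" if "Min (E x y) < i"
          using edge_inv[OF l e, of "i - 1"] edge_inv[OF l' e, of "i - 1"] i that by simp
        have df: "?df f' x i = ?df f' y i" if "i \<in> E x y"
          using leg_inv[OF f e that] leg_inv[OF f' e that] by simp
        consider "Min (E x y) < i" "i < Max (E x y)" | "i = Min (E x y)" | "i = Max (E x y)"
          using i unfolding atLeastAtMost_iff by linarith
        then show ?thesis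
        proof cases
          case 1
          then have "i < hi x" "i < hi y" "lo x < i" "lo y < i" using lk by linarith+
          then show ?thesis using tx ty dr dl 1 eq by simp
        next
          case 2
          then have "i < hi x" "i < hi y" and iE: "i \<in> E x y" and lt: "i < Max (E x y)"
            using lk by simp_all
          moreover from iE have "i \<in> D x" "i \<in> D y" using lk by blast+
          ultimately show ?thesis using tx ty dr[OF lt] df[OF iE] eq by simp blast
        next
          case 3
          then have "lo x < i" "lo y < i" and iE: "i \<in> E x y" and lt: "Min (E x y) < i"
            using lk by simp_all
          moreover from iE have "i \<in> D x" "i \<in> D y" using lk by blast+
          ultimately show ?thesis using tx ty dl[OF lt] df[OF iE] eq by simp blast
        qed
      qed
      have "p t' \<subseteq> Sigma Z (\<lambda>z. {lo z..hi z})" "q t' \<subseteq> Sigma Z (\<lambda>z. {lo z..hi z})"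
        by (auto simp: eq p_def q_def)
      then show "(p t', q t') \<in> spine_vertices \<times> spine_vertices"
        using inv by (intro SigmaI invariant_sets_liftI) simp_all
    qed
    show "inj_on (\<lambda>t. (p t, q t)) ?F"
    proof (rule inj_onI)
      fix t1 t2 assume F1: "t1 \<in> ?F" and F2: "t2 \<in> ?F" and eq: "(p t1, q t1) = (p t2, q t2)"
      obtain r1 l1 f1 where t1: "t1 = (r1, l1, f1)" by (rule prod_cases3)
      obtain r2 l2 f2 where t2: "t2 = (r2, l2, f2)" by (rule prod_cases3)
      have pq: "p (r1, l1, f1) = p (r2, l2, f2)" "q (r1, l1, f1) = q (r2, l2, f2)"
        using eq t1 t2 by simp_all
      have *: "(i < hi z \<longrightarrow> ?dr r1 z i = ?dr r2 z i) \<and> (lo z < i \<longrightarrow> ?dl l1 z i = ?dl l2 z i)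
          \<and> (i \<in> D z \<longrightarrow> ?df f1 z i = ?df f2 z i)" if "z \<in> Z" "lo z \<le> i" "i \<le> hi z" for z i
        using three[OF F1[unfolded t1] that] three[OF F2[unfolded t2] that] unfolding pq by simp
      have spaces: "r1 \<in> spine_edges" "r2 \<in> spine_edges" "l1 \<in> spine_edges" "l2 \<in> spine_edges"
        "f1 \<in> legs" "f2 \<in> legs"
        using F1 F2 t1 t2 by simp_all
      note sub = spaces[THEN invariant_setsD(1)]
      have "(z, i) \<in> r1 \<longleftrightarrow> (z, i) \<in> r2" if "(z, i) \<in> Sigma Z (\<lambda>z. {lo z..<hi z})" for z i
        using *[of z i] that by auto
      then have "r1 = r2" using sub(1,2) by auto
      moreover have "(z, i) \<in> l1 \<longleftrightarrow> (z, i) \<in> l2" if "(z, i) \<in> Sigma Z (\<lambda>z. {lo z..<hi z})" for z i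
        using *[of z "Suc i"] that by auto
      then have "l1 = l2" using sub(3,4) by auto
      moreover have "(z, i) \<in> f1 \<longleftrightarrow> (z, i) \<in> f2" if "(z, i) \<in> Sigma Z D" for z i
        using *[of z i] that finite_D[of z] by auto
      then have "f1 = f2" using sub(5,6) by auto
      ultimately show "t1 = t2" using t1 t2 by simp
    qed
  qed
qed

text \<open>In the logarithm to base two: the components of legs are at most twice the components of nodes plus the
components of inner legs. The spines cancel.\<close>

lemma card_legs_le: "card legs \<le> (card (invariant_sets Z \<Lambda>))\<^sup>2 * card inner_legs"
proof -
  let ?s = "card spine_edges" and ?v = "card spine_vertices" and ?c = "card (invariant_sets Z \<Lambda>)"
  have s: "0 < ?s" using finite_Z by (intro card_invariant_sets_pos) simp
  have "?s\<^sup>2 * card legs \<le> ?v\<^sup>2 * card inner_legs"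
    using card_legs_spine_le by (simp add: card_cartesian_product power2_eq_square mult_ac)
  also have "\<dots> \<le> (?c * ?s)\<^sup>2 * card inner_legs"
    using card_spine_vertices_le by (intro mult_right_mono power_mono) auto
  also have "\<dots> = ?s\<^sup>2 * (?c\<^sup>2 * card inner_legs)" by (simp add: power_mult_distrib)
  finally show ?thesis using s by simp
qed

end

lemma card_invariant_sets_le_Pow: "finite A \<Longrightarrow> card (invariant_sets A R) \<le> 2 ^ card A"
  using card_mono[of "Pow A" "invariant_sets A R"] by (auto simp: invariant_sets_def card_Pow)

text \<open>Each link has an endpoint \<open>n\<^sub>i\<close> that occurs in no earlier link, so the links form a forest. Removing
\<open>n3\<close>, \<open>n2\<close>, \<open>n1\<close> in this order keeps the other endpoint of the link in use available.\<close>

lemma card_invariant_sets_three_links: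
  assumes fin: "finite A" and R: "R \<subseteq> A \<times> A" "(n1, a1) \<in> R \<or> (a1, n1) \<in> R" "(n2, a2) \<in> R \<or> (a2, n2) \<in> R"
    "(n3, a3) \<in> R \<or> (a3, n3) \<in> R"
    and ne: "n1 \<noteq> a1" "n2 \<notin> {a2, n1, a1}" "n3 \<notin> {a3, n2, a2, n1, a1}"
  shows "card (invariant_sets A R) \<le> 2 ^ (card A - 3)"
proof -
  let ?R = "\<lambda>R n. {(x, y) \<in> R. x \<noteq> n \<and> y \<noteq> n}"
  have A: "{n1, a1, n2, a2, n3, a3} \<subseteq> A" using R by auto
  have "card (invariant_sets A R) \<le> card (invariant_sets (A - {n3}) (?R R n3))"
    using fin A R ne by (intro card_invariant_sets_link[of _ a3]) auto
  also have "\<dots> \<le> card (invariant_sets (A - {n3} - {n2}) (?R (?R R n3) n2))"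
    using fin A R ne by (intro card_invariant_sets_link[of _ a2]) auto
  also have "\<dots> \<le> card (invariant_sets (A - {n3} - {n2} - {n1}) (?R (?R (?R R n3) n2) n1))"
    using fin A R ne by (intro card_invariant_sets_link[of _ a1]) auto
  also have "\<dots> \<le> 2 ^ card (A - {n3} - {n2} - {n1})"
    using fin by (intro card_invariant_sets_le_Pow) auto
  also have "card (A - {n3} - {n2} - {n1}) = card A - 3"
    using fin A ne by auto
  finally show ?thesis by simp
qed

text \<open>Three of the links form a forest. If some link is disjoint from the first one, a third link other
than these two and \<open>(x1, y2)\<close> joins them into a path or reaches a new node; this step uses the fourth link.
Otherwise all links share a node with the first one, and any two further links each reach a new node.\<close>

lemma card_invariant_sets_bipartite:
  assumes fin: "finite P" "finite Q" and disj: "P \<inter> Q = {}" and R: "R \<subseteq> P \<times> Q" and four: "4 \<le> card R"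
  shows "card (invariant_sets (P \<union> Q) R) \<le> 2 ^ (card P + card Q - 3)"
proof -
  have finR: "finite R" using R fin finite_subset by blast
  have more: "\<exists>x y. (x, y) \<in> R \<and> (x, y) \<notin> {a, b, c}" for a b c
  proof (rule ccontr)
    assume "\<not> ?thesis"
    then have "R \<subseteq> {a, b, c}" by auto
    then have "card R \<le> card {a, b, c}" by (intro card_mono) auto
    moreover have "card {a, b, c} \<le> 3" by (simp add: card_insert_if)
    ultimately show False using four by simp
  qed
  have card_PQ: "card (P \<union> Q) = card P + card Q" using fin disj by (simp add: card_Un_disjoint)
  note three = card_invariant_sets_three_links[of "P \<union> Q" R, unfolded card_PQ]
  have finU: "finite (P \<union> Q)" "R \<subseteq> (P \<union> Q) \<times> (P \<union> Q)" using fin R by auto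
  have PQ: "x \<in> P \<and> y \<in> Q \<and> x \<notin> Q \<and> y \<notin> P" if "(x, y) \<in> R" for x y using that R disj by auto
  obtain x1 y1 where e1: "(x1, y1) \<in> R" using more by blast
  show ?thesis
  proof (cases "\<exists>x2 y2. (x2, y2) \<in> R \<and> x2 \<noteq> x1 \<and> y2 \<noteq> y1")
    case True
    then obtain x2 y2 where e2: "(x2, y2) \<in> R" "x2 \<noteq> x1" "y2 \<noteq> y1" by blast
    obtain x3 y3 where e3: "(x3, y3) \<in> R" "(x3, y3) \<notin> {(x1, y1), (x2, y2), (x1, y2)}"
      using more by blast
    show ?thesis
    proof (cases "(x3, y3) = (x2, y1)")
      case True
      then show ?thesis using three[of x1 y1 x2 y1 y2 x2] finU e1 e2 e3 PQ by auto
    next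
      case False
      then consider "x3 \<notin> {x1, x2}" | "y3 \<notin> {y1, y2}" using e3 by blast
      then show ?thesis
      proof cases
        case 1
        then show ?thesis using three[of x1 y1 x2 y2 x3 y3] finU e1 e2 e3 PQ by auto
      next
        case 2
        then show ?thesis using three[of x1 y1 x2 y2 y3 x3] finU e1 e2 e3 PQ by auto
      qed
    qed
  next
    case False
    obtain x2 y2 where e2: "(x2, y2) \<in> R" "(x2, y2) \<noteq> (x1, y1)" using more[of "(x1, y1)" "(x1, y1)" "(x1, y1)"] by blast
    obtain x3 y3 where e3: "(x3, y3) \<in> R" "(x3, y3) \<notin> {(x1, y1), (x2, y2)}"
      using more[of "(x1, y1)" "(x2, y2)" "(x2, y2)"] by blast
    have "x2 = x1 \<or> y2 = y1" "x3 = x1 \<or> y3 = y1" using False e2 e3 by blast+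
    then consider "x2 = x1" "x3 = x1" | "x2 = x1" "y3 = y1" "x3 \<noteq> x1"
      | "y2 = y1" "x3 = x1" "x2 \<noteq> x1" | "y2 = y1" "y3 = y1" by blast
    then show ?thesis
    proof cases
      case 1
      then show ?thesis using three[of x1 y1 y2 x1 y3 x1] finU e1 e2 e3 PQ by auto
    next
      case 2
      then show ?thesis using three[of x1 y1 y2 x1 x3 y1] finU e1 e2 e3 PQ by auto
    next
      case 3
      then show ?thesis using three[of x1 y1 x2 y1 y3 x1] finU e1 e2 e3 PQ by auto
    next
      case 4
      then show ?thesis using three[of x1 y1 x2 y1 x3 y1] finU e1 e2 e3 PQ by auto
    qed
  qed
qed

section \<open>Reduced words\<close>

definition flip :: "'x \<times> bool \<Rightarrow> 'x \<times> bool" where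
  "flip d = (fst d, \<not> snd d)"

definition word_inverse :: "'x word \<Rightarrow> 'x word" where
  "word_inverse w = rev (map flip w)"

lemma flip_simps [simp]: "flip (flip d) = d" "fst (flip d) = fst d" "snd (flip d) \<longleftrightarrow> \<not> snd d" "flip d \<noteq> d" "d \<noteq> flip d"
  by (auto simp: flip_def prod_eq_iff)

lemma flip_eq_iff: "flip d = e \<longleftrightarrow> d = flip e"
  by (auto simp: flip_def prod_eq_iff)

lemma word_inverse_simps [simp]: "word_inverse [] = []" "word_inverse (d # w) = word_inverse w @ [flip d]"
  "word_inverse (v @ w) = word_inverse w @ word_inverse v" "word_inverse (word_inverse w) = w"
  "word_inverse w = [] \<longleftrightarrow> w = []"
  by (auto simp: word_inverse_def rev_map comp_def)

lemma reduced_words_Nil [simp]: "[] \<in> reduced_words S"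
  by (simp add: reduced_words_def)

lemma reduced_words_append_iff:
  "v @ w \<in> reduced_words S \<longleftrightarrow> v \<in> reduced_words S \<and> w \<in> reduced_words S \<and>
     (v = [] \<or> w = [] \<or> hd w \<noteq> flip (last v))"
  by (auto simp: reduced_words_def successively_append_iff flip_def prod_eq_iff)

lemma reduced_words_Cons_iff:
  "d # w \<in> reduced_words S \<longleftrightarrow> fst d \<in> S \<and> w \<in> reduced_words S \<and> (w = [] \<or> hd w \<noteq> flip d)"
  by (auto simp: reduced_words_def successively_Cons flip_def prod_eq_iff)

lemma word_inverse_reduced [simp]: "word_inverse w \<in> reduced_words S \<longleftrightarrow> w \<in> reduced_words S"
proof -
  have *: "word_inverse w \<in> reduced_words S" if "w \<in> reduced_words S" for w :: "'a word"
    using that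
  proof (induction w)
    case (Cons d w)
    then have "w = [] \<or> last (word_inverse w) = flip (hd w)"
      by (cases w) auto
    with Cons show ?case
      by (auto simp: reduced_words_append_iff reduced_words_Cons_iff flip_eq_iff)
  qed simp
  show ?thesis using *[of w] *[of "word_inverse w"] by auto
qed

text \<open>Cancelling at the junction of two reduced words removes a suffix \<open>q\<close> of the first and its inverse from
the second.\<close>

lemma reduced_cancellation:
  assumes "v \<in> reduced_words S" and "w \<in> reduced_words S"
  obtains a q b where "v = a @ q" "w = word_inverse q @ b" "a @ b \<in> reduced_words S"
proof -
  have "\<exists>a q b. v = a @ q \<and> w = word_inverse q @ b \<and> a @ b \<in> reduced_words S"
    using assms
  proof (induction v arbitrary: w rule: rev_induct)
    case Nil
    then show ?case by auto
  next
    case (snoc d v)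
    show ?case
    proof (cases "w \<noteq> [] \<and> hd w = flip d")
      case True
      then obtain w' where w: "w = flip d # w'" by (cases w) auto
      have "v \<in> reduced_words S" "w' \<in> reduced_words S"
        using snoc.prems w by (auto simp: reduced_words_append_iff reduced_words_Cons_iff)
      then obtain a q b where "v = a @ q" "w' = word_inverse q @ b" "a @ b \<in> reduced_words S"
        using snoc.IH by blast
      then show ?thesis
        using w by (intro exI[of _ a] exI[of _ "q @ [d]"] exI[of _ b]) auto
    next
      case False
      then have "(v @ [d]) @ w \<in> reduced_words S"
        using snoc.prems by (subst reduced_words_append_iff) auto
      then show ?thesis by (intro exI[of _ "v @ [d]"] exI[of _ "[]"] exI[of _ w]) auto
    qed
  qed
  then show ?thesis using that by blast
qed

definition cyclically_reduced :: "'x word \<Rightarrow> bool" where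
  "cyclically_reduced w \<longleftrightarrow> w \<noteq> [] \<and> hd w \<noteq> flip (last w)"

lemma cyclic_reduction:
  assumes "w \<in> reduced_words S" and "w \<noteq> []"
  obtains u c where "w = u @ c @ word_inverse u" "cyclically_reduced c"
proof -
  have "\<exists>u c. w = u @ c @ word_inverse u \<and> cyclically_reduced c"
    using assms
  proof (induction "length w" arbitrary: w rule: less_induct)
    case less
    show ?case
    proof (cases "cyclically_reduced w")
      case True
      then show ?thesis by (intro exI[of _ "[]"] exI[of _ w]) simp
    next
      case False
      then have eq: "hd w = flip (last w)" using less.prems by (simp add: cyclically_reduced_def)
      obtain d w' where w: "w = d # w'" using less.prems by (cases w) auto
      have "w' \<noteq> []" using eq w by (auto simp: flip_eq_iff)
      then obtain v where w': "w' = v @ [flip d]" using eq w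
        by (metis append_butlast_last_id flip_eq_iff last_ConsR list.sel(1))
      have red: "d # v @ [flip d] \<in> reduced_words S" using less.prems w w' by simp
      have v: "v \<in> reduced_words S" "v \<noteq> []"
        using red by (auto simp: reduced_words_Cons_iff reduced_words_append_iff)
      then obtain u c where "v = u @ c @ word_inverse u" "cyclically_reduced c"
        using less.hyps[of v] w w' by auto
      then show ?thesis using w w' by (intro exI[of _ "d # u"] exI[of _ c]) simp
    qed
  qed
  then show ?thesis using that by blast
qed

lemma first_exit:
  assumes "P []" and "\<not> P w"
  obtains p d s where "w = p @ d # s" "P p" "\<not> P (p @ [d])"
proof -
  have "\<exists>p d s. w = p @ d # s \<and> P p \<and> \<not> P (p @ [d])"
    using assms
  proof (induction w rule: rev_induct)
    case Nil
    then show ?case by simp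
  next
    case (snoc e w)
    then show ?case
      by (cases "P w") (force, fastforce)
  qed
  then show ?thesis using that by blast
qed

lemma finite_prefixes: "finite {p. \<exists>r. w = p @ r}"
proof (rule finite_subset)
  show "{p. \<exists>r. w = p @ r} \<subseteq> (\<lambda>n. take n w) ` {..length w}"
  proof
    fix p assume "p \<in> {p. \<exists>r. w = p @ r}"
    then obtain r where "w = p @ r" by blast
    then show "p \<in> (\<lambda>n. take n w) ` {..length w}" by (intro image_eqI[of _ _ "length p"]) simp_all
  qed
qed simp

section \<open>Core graphs of subgroups\<close>

text \<open>The letters are evaluated by an arbitrary function \<open>lv\<close>, so that a conjugate of a free basis
is again an instance with the same words; this allows the base point to be moved.\<close>

locale free_evaluation = group G for G (structure) +
  fixes S :: "'x set" and lv :: "'x \<times> bool \<Rightarrow> 'a"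
  assumes lv_closed: "fst d \<in> S \<Longrightarrow> lv d \<in> carrier G"
    and lv_flip: "fst d \<in> S \<Longrightarrow> lv (flip d) = inv (lv d)"
    and bij: "bij_betw (\<lambda>w. foldr (\<lambda>d g. lv d \<otimes> g) w \<one>) (reduced_words S) (carrier G)"
begin

definition wv :: "'x word \<Rightarrow> 'a" where
  "wv w = foldr (\<lambda>d g. lv d \<otimes> g) w \<one>"

definition nf :: "'a \<Rightarrow> 'x word" where
  "nf g = inv_into (reduced_words S) wv g"

abbreviation on_S :: "'x word \<Rightarrow> bool" where
  "on_S w \<equiv> fst ` set w \<subseteq> S"

lemma reduced_on_S: "w \<in> reduced_words S \<Longrightarrow> on_S w"
  by (simp add: reduced_words_def)

lemma wv_simps [simp]: "wv [] = \<one>" "wv (d # w) = lv d \<otimes> wv w"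
  by (simp_all add: wv_def)

lemma wv_closed [simp]: "on_S w \<Longrightarrow> wv w \<in> carrier G"
  by (induction w) (auto simp: lv_closed)

lemma wv_append: "on_S v \<Longrightarrow> on_S w \<Longrightarrow> wv (v @ w) = wv v \<otimes> wv w"
  by (induction v) (auto simp: lv_closed m_assoc)

lemma on_S_word_inverse [simp]: "on_S (word_inverse w) \<longleftrightarrow> on_S w"
  by (simp add: word_inverse_def image_image)

lemma wv_word_inverse: "on_S w \<Longrightarrow> wv (word_inverse w) = inv (wv w)"
  by (induction w) (auto simp: wv_append lv_closed lv_flip inv_mult_group)

lemma nf_reduced: "g \<in> carrier G \<Longrightarrow> nf g \<in> reduced_words S"
  and wv_nf: "g \<in> carrier G \<Longrightarrow> wv (nf g) = g"
  and nf_wv: "w \<in> reduced_words S \<Longrightarrow> nf (wv w) = w"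
proof -
  have b: "bij_betw wv (reduced_words S) (carrier G)"
    using bij unfolding wv_def .
  show "g \<in> carrier G \<Longrightarrow> nf g \<in> reduced_words S"
    unfolding nf_def using b by (metis bij_betw_imp_surj_on inv_into_into)
  show "g \<in> carrier G \<Longrightarrow> wv (nf g) = g"
    unfolding nf_def using b by (metis bij_betw_imp_surj_on f_inv_into_f)
  show "w \<in> reduced_words S \<Longrightarrow> nf (wv w) = w"
    unfolding nf_def using b by (metis bij_betw_def inv_into_f_f)
qed

lemma nf_on_S: "g \<in> carrier G \<Longrightarrow> on_S (nf g)"
  using nf_reduced reduced_on_S by blast

lemma nf_one [simp]: "nf \<one> = []"
  using nf_wv[of "[]"] by simp

lemma nf_inv: "g \<in> carrier G \<Longrightarrow> nf (inv g) = word_inverse (nf g)"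
  by (metis nf_on_S nf_reduced nf_wv word_inverse_reduced wv_nf wv_word_inverse)

lemma nf_lv: "fst d \<in> S \<Longrightarrow> nf (lv d) = [d]"
  using nf_wv[of "[d]"] by (simp add: reduced_words_Cons_iff lv_closed)

lemma nf_mult:
  assumes "g \<in> carrier G" "h \<in> carrier G"
  obtains a q b where "nf g = a @ q" "nf h = word_inverse q @ b" "nf (g \<otimes> h) = a @ b"
    "on_S a" "on_S q" "on_S b"
proof -
  obtain a q b where *: "nf g = a @ q" "nf h = word_inverse q @ b" "a @ b \<in> reduced_words S"
    by (rule reduced_cancellation[OF nf_reduced[OF assms(1)] nf_reduced[OF assms(2)]])
  have S: "on_S a" "on_S q" "on_S b" using nf_on_S[OF assms(1)] nf_on_S[OF assms(2)] * by auto
  have "g \<otimes> h = (wv a \<otimes> wv q) \<otimes> (inv (wv q) \<otimes> wv b)"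
    using * S wv_nf[OF assms(1)] wv_nf[OF assms(2)] by (metis on_S_word_inverse wv_append wv_word_inverse)
  also have "\<dots> = wv a \<otimes> wv b"
  proof -
    have "wv q \<otimes> (inv (wv q) \<otimes> wv b) = wv b" using S by (simp add: m_assoc[symmetric])
    then show ?thesis using S by (simp add: m_assoc)
  qed
  also have "\<dots> = wv (a @ b)" using S by (simp add: wv_append)
  finally have "nf (g \<otimes> h) = a @ b" using nf_wv *(3) by simp
  then show ?thesis using that * S by blast
qed

text \<open>The half-edges are those traversed by the paths of the elements of \<open>H\<close>, given by the initial vertex
and the letter of the step. Vertices are right cosets of \<open>H\<close>.\<close>

definition half_edges :: "'a set \<Rightarrow> ('a set \<times> ('x \<times> bool)) set" where
  "half_edges H = {(H #> wv p, d) |p d. \<exists>h\<in>H. \<exists>r. nf h = p @ d # r}"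

definition vertices :: "'a set \<Rightarrow> 'a set set" where
  "vertices H = {H #> wv p |p. \<exists>h\<in>H. \<exists>r. nf h = p @ r}"

text \<open>An unoriented edge is represented by its half-edge whose letter is a generator.\<close>

definition edges :: "'a set \<Rightarrow> ('a set \<times> ('x \<times> bool)) set" where
  "edges H = {(x, d) \<in> half_edges H. snd d}"

lemma half_edgesI: "h \<in> H \<Longrightarrow> nf h = p @ d # r \<Longrightarrow> (H #> wv p, d) \<in> half_edges H"
  unfolding half_edges_def by blast

lemma verticesI: "h \<in> H \<Longrightarrow> nf h = p @ r \<Longrightarrow> H #> wv p \<in> vertices H"
  unfolding vertices_def by blast

lemma vertices_closed:
  assumes "subgroup H G" "x \<in> vertices H"
  obtains v where "v \<in> carrier G" "x = H #> v"
proof -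
  obtain p h r where p: "x = H #> wv p" "h \<in> H" "nf h = p @ r" using assms by (auto simp: vertices_def)
  then have "on_S p" using nf_on_S[of h] subgroup.mem_carrier[OF assms(1)] by auto
  then show ?thesis using that[of "wv p"] p by simp
qed

lemma coset_step:
  "subgroup H G \<Longrightarrow> v \<in> carrier G \<Longrightarrow> fst d \<in> S \<Longrightarrow> (H #> v) #> lv d = H #> (v \<otimes> lv d)"
  by (simp add: coset_mult_assoc lv_closed subgroup.subset)

lemma prefix_step:
  assumes "subgroup H G" "h \<in> H" "nf h = p @ d # r"
  shows "on_S p" "fst d \<in> S" "H #> wv (p @ [d]) = (H #> wv p) #> lv d"
proof -
  have "on_S (nf h)" by (rule nf_on_S[OF subgroup.mem_carrier[OF assms(1,2)]])
  then show S: "on_S p" "fst d \<in> S" using assms(3) by auto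
  then have "wv (p @ [d]) = wv p \<otimes> lv d" by (simp add: wv_append lv_closed)
  then show "H #> wv (p @ [d]) = (H #> wv p) #> lv d"
    using S coset_step[OF assms(1)] by simp
qed

lemma half_edges_letter: "subgroup H G \<Longrightarrow> (x, d) \<in> half_edges H \<Longrightarrow> fst d \<in> S"
  using prefix_step(2) by (auto simp: half_edges_def)

lemma half_edges_vertices:
  assumes "subgroup H G" "(x, d) \<in> half_edges H"
  shows "x \<in> vertices H" "x #> lv d \<in> vertices H"
proof -
  obtain p h r where *: "x = H #> wv p" "h \<in> H" "nf h = p @ d # r" using assms by (auto simp: half_edges_def)
  show "x \<in> vertices H" using * by (auto intro: verticesI)
  show "x #> lv d \<in> vertices H"
    using * prefix_step[OF assms(1) *(2,3)] verticesI[of h H "p @ [d]" r] by simp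
qed

lemma coset_mem [simp]: "subgroup H G \<Longrightarrow> h \<in> H \<Longrightarrow> H #> h = H"
  by (rule coset_join2) (auto dest: subgroup.mem_carrier)

lemma base_vertex [simp]: "subgroup H G \<Longrightarrow> H \<in> vertices H"
  using verticesI[of \<one> H "[]" "[]"] subgroup.one_closed[of H G] by simp

text \<open>The path of \<open>inv h\<close> is the path of \<open>h\<close> traversed backwards, translated by \<open>inv h\<close>.\<close>

lemma half_edges_flip:
  assumes H: "subgroup H G" and e: "(x, d) \<in> half_edges H"
  shows "(x #> lv d, flip d) \<in> half_edges H" and "(x #> lv d) #> lv (flip d) = x"
proof -
  obtain p h r where *: "x = H #> wv p" "h \<in> H" "nf h = p @ d # r" using e by (auto simp: half_edges_def)
  have h: "h \<in> carrier G" by (rule subgroup.mem_carrier[OF H *(2)])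
  have S: "on_S p" "fst d \<in> S" "on_S r" using nf_on_S[OF h] * by auto
  have ih: "inv h \<in> H" by (rule subgroup.m_inv_closed[OF H *(2)])
  have "nf (inv h) = word_inverse r @ flip d # word_inverse p" using nf_inv[OF h] * by simp
  then have "(H #> wv (word_inverse r), flip d) \<in> half_edges H" using ih by (rule half_edgesI[rotated])
  moreover have "H #> wv (word_inverse r) = x #> lv d"
  proof -
    have "h = wv p \<otimes> (lv d \<otimes> wv r)" using wv_nf[OF h] * S by (simp add: wv_append)
    then have "h \<otimes> inv (wv r) = wv p \<otimes> lv d" using S by (simp add: m_assoc lv_closed)
    moreover have "H #> (h \<otimes> inv (wv r)) = H #> inv (wv r)"
      using S h coset_mult_assoc[OF subgroup.subset[OF H] h, of "inv (wv r)"] coset_mem[OF H *(2)] by simp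
    ultimately show ?thesis using S H * by (simp add: wv_word_inverse coset_step)
  qed
  ultimately show "(x #> lv d, flip d) \<in> half_edges H" by simp
  show "(x #> lv d) #> lv (flip d) = x"
    using S H * by (simp add: coset_step lv_flip lv_closed m_assoc coset_mult_assoc subgroup.subset)
qed

lemma edges_subset: "edges H \<subseteq> half_edges H"
  by (auto simp: edges_def)

lemma half_edges_eq:
  assumes "subgroup H G"
  shows "half_edges H = edges H \<union> (\<lambda>(x, d). (x #> lv d, flip d)) ` edges H"
proof (intro equalityI subsetI)
  fix e assume e: "e \<in> half_edges H"
  obtain x d where xd: "e = (x, d)" by (cases e)
  show "e \<in> edges H \<union> (\<lambda>(x, d). (x #> lv d, flip d)) ` edges H"
  proof (cases "snd d")
    case False
    then have "(x #> lv d, flip d) \<in> edges H"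
      using half_edges_flip(1)[OF assms] e xd by (auto simp: edges_def)
    moreover have "e = (\<lambda>(x, d). (x #> lv d, flip d)) (x #> lv d, flip d)"
      using half_edges_flip(2)[OF assms, of x d] e xd by simp
    ultimately show ?thesis by (intro UnI2 rev_image_eqI)
  qed (use e xd in \<open>auto simp: edges_def\<close>)
next
  fix e assume "e \<in> edges H \<union> (\<lambda>(x, d). (x #> lv d, flip d)) ` edges H"
  moreover have "(x #> lv d, flip d) \<in> half_edges H" if "(x, d) \<in> edges H" for x d
    using half_edges_flip(1)[OF assms] edges_subset that by blast
  ultimately show "e \<in> half_edges H" using edges_subset by fast
qed

lemma card_half_edges:
  assumes "subgroup H G" "finite (half_edges H)"
  shows "card (half_edges H) = 2 * card (edges H)"
proof -
  let ?f = "\<lambda>(x, d). (x #> lv d, flip d)"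
  have inj: "inj_on ?f (edges H)"
  proof (rule inj_onI)
    fix e e' assume e: "e \<in> edges H" "e' \<in> edges H" "?f e = ?f e'"
    obtain x d x' d' where eq: "e = (x, d)" "e' = (x', d')" by (cases e; cases e')
    have d: "d = d'" using e(3) eq by (simp add: flip_eq_iff)
    have mem: "(x, d) \<in> half_edges H" "(x', d') \<in> half_edges H"
      using e(1,2) eq by (auto simp: edges_def)
    have "x = (x #> lv d) #> lv (flip d)" by (rule half_edges_flip(2)[OF assms(1) mem(1), symmetric])
    also have "x #> lv d = x' #> lv d'" using e(3) eq by simp
    also have "(x' #> lv d') #> lv (flip d) = x'"
      unfolding d by (rule half_edges_flip(2)[OF assms(1) mem(2)])
    finally show "e = e'" using d eq by simp
  qed
  have "edges H \<inter> ?f ` edges H = {}" by (auto simp: edges_def)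
  then show ?thesis
    using half_edges_eq[OF assms(1)] assms(2) finite_subset[OF edges_subset assms(2)] card_image[OF inj]
    by (simp add: card_Un_disjoint)
qed

text \<open>Only the paths of the generators and of their inverses contribute: by cancellation, a vertex on the path of
\<open>g \<otimes> h\<close> lies on the path of \<open>g\<close> or on the translate by \<open>g\<close> of the path of \<open>h\<close>.\<close>

lemma finite_core:
  assumes A: "finite A" "A \<subseteq> carrier G" and H: "subgroup H G" "generate G A = H"
  shows "finite (half_edges H)" "finite (vertices H)"
proof -
  let ?pre = "\<lambda>w. (\<lambda>p. H #> wv p) ` {p. \<exists>r. w = p @ r}"
  define V where "V = insert H (\<Union>a\<in>A. ?pre (nf a) \<union> ?pre (nf (inv a)))"
  define W where "W = (\<Union>a\<in>A. set (nf a) \<union> set (nf (inv a)))"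
  have fin: "finite V" "finite W" using A by (auto simp: V_def W_def finite_prefixes)
  have VI: "H #> wv p \<in> V" if "a \<in> A" "nf a = p @ r \<or> nf (inv a) = p @ r" for a p r
    unfolding V_def using that by blast
  have good: "set (nf g) \<subseteq> W \<and> (\<forall>p r. nf g = p @ r \<longrightarrow> H #> wv p \<in> V)" if "g \<in> generate G A" for g
    using that
  proof (induction rule: generate.induct)
    case one
    then show ?case using coset_mult_one[OF subgroup.subset[OF H(1)]] by (simp add: V_def)
  next
    case (incl h)
    then have "set (nf h) \<subseteq> W" by (auto simp: W_def)
    then show ?case using VI incl by blast
  next
    case (inv h)
    then have "set (nf (inv h)) \<subseteq> W" by (auto simp: W_def)
    then show ?case using VI inv by blast
  next
    case (eng g h)
    have H': "g \<in> H" "h \<in> H" using eng.hyps H by auto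
    then have gh: "g \<in> carrier G" "h \<in> carrier G" using subgroup.mem_carrier[OF H(1)] by simp_all
    obtain a q b where *: "nf g = a @ q" "nf h = word_inverse q @ b" "nf (g \<otimes> h) = a @ b"
      "on_S a" "on_S q" "on_S b" by (rule nf_mult[OF gh])
    have "H #> wv p \<in> V" if p: "a @ b = p @ r" for p r
    proof -
      consider us where "a = p @ us" | us where "p = a @ us" "b = us @ r"
        using p by (auto simp: append_eq_append_conv2)
      then show ?thesis
      proof cases
        case 1
        then show ?thesis using eng.IH(1) * by auto
      next
        case 2
        have S: "on_S us" using 2 * by auto
        have "wv a = g \<otimes> inv (wv q)"
          using wv_nf[OF gh(1)] * by (simp add: wv_append inv_solve_right gh(1))
        then have "wv p = g \<otimes> wv (word_inverse q @ us)"
          using 2 * S gh by (simp add: wv_append wv_word_inverse m_assoc)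
        moreover have "wv (word_inverse q @ us) \<in> carrier G"
          using * S by (intro wv_closed) (simp add: image_Un)
        ultimately have "H #> wv p = H #> wv (word_inverse q @ us)"
          using coset_mult_assoc[OF subgroup.subset[OF H(1)] gh(1), of "wv (word_inverse q @ us)"]
            coset_mem[OF H(1) H'(1)] by simp
        moreover have "nf h = (word_inverse q @ us) @ r" using * 2 by simp
        ultimately show ?thesis using eng.IH(2) by metis
      qed
    qed
    moreover have "set (nf (g \<otimes> h)) \<subseteq> W" using eng.IH * by auto
    ultimately show ?case using * by auto
  qed
  have "half_edges H \<subseteq> V \<times> W"
  proof
    fix e assume "e \<in> half_edges H"
    then obtain p d h r where "e = (H #> wv p, d)" "h \<in> H" "nf h = p @ d # r" by (auto simp: half_edges_def)
    then show "e \<in> V \<times> W" using good[of h] H by auto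
  qed
  then show "finite (half_edges H)" using fin finite_subset by blast
  have "vertices H \<subseteq> V" using good H by (auto simp: vertices_def)
  then show "finite (vertices H)" using fin finite_subset by blast
qed

end

section \<open>Homomorphisms to the group of order two\<close>

text \<open>A homomorphism is represented by the set of elements that it does not send to zero.\<close>

definition mod2_homs :: "('a, 'b) monoid_scheme \<Rightarrow> 'a set \<Rightarrow> 'a set set" where
  "mod2_homs G M = {\<phi>. \<phi> \<subseteq> M \<and> (\<forall>x\<in>M. \<forall>y\<in>M. x \<otimes>\<^bsub>G\<^esub> y \<in> \<phi> \<longleftrightarrow> (x \<in> \<phi>) \<noteq> (y \<in> \<phi>))}"

lemma mod2_homsD:
  assumes "\<phi> \<in> mod2_homs G M"
  shows "\<phi> \<subseteq> M" "x \<in> M \<Longrightarrow> y \<in> M \<Longrightarrow> x \<otimes>\<^bsub>G\<^esub> y \<in> \<phi> \<longleftrightarrow> (x \<in> \<phi>) \<noteq> (y \<in> \<phi>)"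
  using assms by (auto simp: mod2_homs_def)

context group begin

lemma mod2_homs_one: "subgroup M G \<Longrightarrow> \<phi> \<in> mod2_homs G M \<Longrightarrow> \<one> \<notin> \<phi>"
  using mod2_homsD(2)[of \<phi> G M \<one> \<one>] subgroup.one_closed[of M G] by auto

lemma mod2_homs_inv: 
  assumes "subgroup M G" "\<phi> \<in> mod2_homs G M" "x \<in> M"
  shows "inv x \<in> \<phi> \<longleftrightarrow> x \<in> \<phi>"
  using mod2_homsD(2)[OF assms(2,3), of "inv x"] mod2_homs_one[OF assms(1,2)]
    subgroup.m_inv_closed[OF assms(1,3)] subgroup.mem_carrier[OF assms(1,3)] by simp

lemma mod2_homs_eqI:
  assumes M: "subgroup M G" "generate G A = M"
    and homs: "\<phi> \<in> mod2_homs G M" "\<psi> \<in> mod2_homs G M" and eq: "\<And>a. a \<in> A \<Longrightarrow> a \<in> \<phi> \<longleftrightarrow> a \<in> \<psi>"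
  shows "\<phi> = \<psi>"
proof -
  have "x \<in> \<phi> \<longleftrightarrow> x \<in> \<psi>" if "x \<in> generate G A" for x
    using that
  proof (induction rule: generate.induct)
    case one
    then show ?case using mod2_homs_one[OF M(1) homs(1)] mod2_homs_one[OF M(1) homs(2)] by simp
  next
    case (incl h)
    then show ?case using eq by blast
  next
    case (inv h)
    then have "h \<in> M" using M(2) generate.incl[of h A G] by simp
    then show ?case using mod2_homs_inv[OF M(1) homs(1)] mod2_homs_inv[OF M(1) homs(2)] eq[OF inv] by simp
  next
    case (eng x y)
    then have "x \<in> M" "y \<in> M" using M(2) by auto
    then show ?case using mod2_homsD(2)[OF homs(1)] mod2_homsD(2)[OF homs(2)] eng.IH by simp
  qed
  then show ?thesis using mod2_homsD(1)[OF homs(1)] mod2_homsD(1)[OF homs(2)] M(2) by blast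
qed

lemma card_mod2_homs_le:
  assumes M: "subgroup M G" "generate G A = M" and "finite A"
  shows "finite (mod2_homs G M)" "card (mod2_homs G M) \<le> 2 ^ card A"
proof -
  have inj: "inj_on (\<lambda>\<phi>. \<phi> \<inter> A) (mod2_homs G M)"
    by (rule inj_onI, rule mod2_homs_eqI[OF M]) blast+
  have sub: "(\<lambda>\<phi>. \<phi> \<inter> A) ` mod2_homs G M \<subseteq> Pow A" by blast
  show "finite (mod2_homs G M)" using inj_on_finite[OF inj sub] assms(3) by simp
  show "card (mod2_homs G M) \<le> 2 ^ card A"
    using card_inj_on_le[OF inj sub] assms(3) by (simp add: card_Pow)
qed

end

section \<open>Generators from a spanning tree\<close>

context free_evaluation begin

text \<open>A subtree with \<open>n\<close> vertices \<open>U\<close> and edges \<open>F\<close> that contains the base point is lifted to representatives \<open>t\<close> of the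
cosets. As long as \<open>U\<close> is not everything, the path to a vertex outside \<open>U\<close> leaves \<open>U\<close> at some edge, which
extends the tree.\<close>

lemma spanning_tree:
  assumes M: "subgroup M G" and fin: "finite (vertices M)" "finite (edges M)"
    and n: "0 < n" "n \<le> card (vertices M)"
  shows "\<exists>U t F. U \<subseteq> vertices M \<and> M \<in> U \<and> card U = n \<and> F \<subseteq> edges M \<and> Suc (card F) = n \<and> t M = \<one> \<and>
     (\<forall>x\<in>U. t x \<in> carrier G \<and> M #> t x = x) \<and>
     (\<forall>(x, d)\<in>F. x \<in> U \<and> x #> lv d \<in> U \<and> t (x #> lv d) = t x \<otimes> lv d)"
  using n
proof (induction n)
  case 0
  then show ?case by simp
next
  case (Suc n)
  show ?case
  proof (cases "n = 0")
    case True
    then show ?thesis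
      by (intro exI[of _ "{M}"] exI[of _ "\<lambda>_. \<one>"] exI[of _ "{}"])
        (use M in \<open>simp add: coset_mult_one subgroup.subset\<close>)
  next
    case False
    then obtain U t F where U: "U \<subseteq> vertices M" "M \<in> U" "card U = n"
      and F: "F \<subseteq> edges M" "Suc (card F) = n" and t: "t M = \<one>"
      and tU: "\<And>x. x \<in> U \<Longrightarrow> t x \<in> carrier G \<and> M #> t x = x"
      and tF: "\<And>x d. (x, d) \<in> F \<Longrightarrow> x \<in> U \<and> x #> lv d \<in> U \<and> t (x #> lv d) = t x \<otimes> lv d"
      using Suc by (auto split: prod.splits)
    have finU: "finite U" "finite F" using U F fin finite_subset by blast+
    have "U \<noteq> vertices M" using U(3) Suc.prems by auto
    then obtain y where y: "y \<in> vertices M" "y \<notin> U" using U(1) by blast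
    then obtain w h r where w: "y = M #> wv w" "h \<in> M" "nf h = w @ r" by (auto simp: vertices_def)
    have base: "M #> wv [] \<in> U" using U(2) M by (simp add: coset_mult_one subgroup.subset)
    have out: "\<not> M #> wv w \<in> U" using y w by simp
    obtain p d s where p: "w = p @ d # s" "M #> wv p \<in> U" "M #> wv (p @ [d]) \<notin> U"
      using first_exit[of "\<lambda>w. M #> wv w \<in> U" w, OF base out] by blast
    define x where "x = M #> wv p"
    define z where "z = x #> lv d"
    have nfh: "nf h = p @ d # (s @ r)" using w p by simp
    have e: "(x, d) \<in> half_edges M" using half_edgesI[OF w(2) nfh] x_def by simp
    have d: "fst d \<in> S" by (rule half_edges_letter[OF M e])
    have xz: "x \<in> U" "z \<notin> U" using p prefix_step(3)[OF M w(2) nfh] by (simp_all add: x_def z_def)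
    have zV: "z \<in> vertices M" unfolding z_def by (rule half_edges_vertices(2)[OF M e])
    define t' where "t' = t(z := t x \<otimes> lv d)"
    define e0 where "e0 = (if snd d then (x, d) else (z, flip d))"
    have e0: "e0 \<in> edges M"
      using e half_edges_flip(1)[OF M e] by (auto simp: e0_def edges_def z_def)
    have return: "z #> lv (flip d) = x" unfolding z_def by (rule half_edges_flip(2)[OF M e])
    have e0F: "e0 \<notin> F" using tF[of x d] tF[of z "flip d"] xz by (auto simp: e0_def z_def[symmetric])
    have t'U: "t' u = t u" if "u \<in> U" for u using xz that by (auto simp: t'_def)
    have t'z: "t' z = t x \<otimes> lv d" by (simp add: t'_def)
    have tx: "t x \<in> carrier G" "M #> t x = x" using tU xz by auto
    have 1: "insert z U \<subseteq> vertices M" "M \<in> insert z U" "card (insert z U) = Suc n"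
      using zV U xz finU by auto
    have 2: "insert e0 F \<subseteq> edges M" "Suc (card (insert e0 F)) = Suc n"
      using e0 F e0F finU by auto
    have 3: "t' M = \<one>" using t'U U(2) t by simp
    have 4: "t' u \<in> carrier G \<and> M #> t' u = u" if "u \<in> insert z U" for u
    proof (cases "u = z")
      case True
      have "M #> (t x \<otimes> lv d) = z" using coset_step[OF M tx(1) d] unfolding tx(2) z_def by simp
      then show ?thesis unfolding True t'z using tx(1) d by (simp add: lv_closed)
    next
      case False
      then show ?thesis using tU t'U that by auto
    qed
    have 5: "u \<in> insert z U \<and> u #> lv c \<in> insert z U \<and> t' (u #> lv c) = t' u \<otimes> lv c"
      if "(u, c) \<in> insert e0 F" for u c
    proof (cases "(u, c) = e0")
      case True
      show ?thesis
      proof (cases "snd d")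
        case True
        then have uc: "u = x" "c = d" using \<open>(u, c) = e0\<close> by (auto simp: e0_def)
        show ?thesis unfolding uc using xz t'U[OF xz(1)] t'z by (simp add: z_def[symmetric])
      next
        case False
        then have uc: "u = z" "c = flip d" using \<open>(u, c) = e0\<close> by (auto simp: e0_def)
        show ?thesis unfolding uc return t'U[OF xz(1)] t'z
          using xz tx d by (simp add: m_assoc lv_closed lv_flip)
      qed
    next
      case False
      then have "(u, c) \<in> F" using that by auto
      then show ?thesis using tF[of u c] t'U by auto
    qed
    have 6: "\<forall>(u, c)\<in>insert e0 F. u \<in> insert z U \<and> u #> lv c \<in> insert z U \<and> t' (u #> lv c) = t' u \<otimes> lv c"
    proof
      fix e assume "e \<in> insert e0 F"
      then show "case e of (u, c) \<Rightarrow> u \<in> insert z U \<and> u #> lv c \<in> insert z U \<and> t' (u #> lv c) = t' u \<otimes> lv c"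
        using 5[of "fst e" "snd e"] by (simp only: prod.case_eq_if prod.collapse)
    qed
    show ?thesis
      by (intro exI[of _ "insert z U"] exI[of _ t'] exI[of _ "insert e0 F"] conjI ballI 1 2 3 4 6)
  qed
qed

lemma coset_eq_imp_mem:
  assumes M: "subgroup M G" and "u \<in> carrier G" "v \<in> carrier G" "M #> u = M #> v"
  shows "u \<otimes> inv v \<in> M"
proof -
  have "u \<in> M #> v" using rcos_self[OF assms(2) M] assms(4) by simp
  then obtain m where "m \<in> M" "u = m \<otimes> v" by (auto simp: r_coset_def)
  then show ?thesis using assms subgroup.mem_carrier[OF M] by (simp add: m_assoc)
qed

text \<open>Each half-edge \<open>(x, d)\<close> gives the element \<open>\<gamma> x d\<close> of \<open>M\<close> that closes up the path through \<open>t x\<close>, \<open>d\<close> and back. It is trivial on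
the tree, and an element of \<open>M\<close> is the product of the \<open>\<gamma>\<close> along its path. There are \<open>E - (V - 1)\<close> edges
outside the tree.\<close>

lemma generators_of_core:
  assumes M: "subgroup M G" and fin: "finite (vertices M)" "finite (edges M)"
  shows "\<exists>A. finite A \<and> A \<subseteq> M \<and> generate G A = M \<and> card A + card (vertices M) \<le> Suc (card (edges M))"
proof -
  have pos: "0 < card (vertices M)" using fin base_vertex[OF M] by (auto simp: card_gt_0_iff)
  obtain U t F where U: "U \<subseteq> vertices M" "card U = card (vertices M)"
      and F: "F \<subseteq> edges M" "Suc (card F) = card (vertices M)" and t: "t M = \<one>"
      and tU: "\<And>x. x \<in> U \<Longrightarrow> t x \<in> carrier G \<and> M #> t x = x"
      and tF: "\<And>x d. (x, d) \<in> F \<Longrightarrow> t (x #> lv d) = t x \<otimes> lv d"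
    using spanning_tree[OF M fin pos order.refl] by (auto split: prod.splits)
  have UV: "U = vertices M" using U fin by (simp add: card_subset_eq)
  define \<gamma> where "\<gamma> x d = t x \<otimes> lv d \<otimes> inv t (x #> lv d)" for x d
  define A where "A = (\<lambda>(x, d). \<gamma> x d) ` (edges M - F)"
  have tV: "t x \<in> carrier G" "M #> t x = x" if "x \<in> vertices M" for x using tU UV that by auto
  have \<gamma>M: "\<gamma> x d \<in> M" if "(x, d) \<in> half_edges M" for x d
    unfolding \<gamma>_def
    using coset_eq_imp_mem[OF M, of "t x \<otimes> lv d" "t (x #> lv d)"] coset_step[OF M, of "t x" d]
      tV half_edges_vertices[OF M that] half_edges_letter[OF M that] by (simp add: lv_closed)
  have AM: "A \<subseteq> M" using \<gamma>M edges_subset[of M] by (auto simp: A_def subset_iff)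
  have Ac: "A \<subseteq> carrier G" using AM subgroup.subset[OF M] by blast
  have gen_sub: "subgroup (generate G A) G" by (rule generate_is_subgroup[OF Ac])
  have pos_gen: "\<gamma> x d \<in> generate G A" if e: "(x, d) \<in> edges M" for x d
  proof (cases "(x, d) \<in> F")
    case True
    then have "\<gamma> x d = \<one>" using tF[OF True] tV half_edges_vertices[OF M] e edges_subset
      by (metis \<gamma>_def r_inv subsetD)
    then show ?thesis by (simp add: generate.one)
  next
    case False
    then show ?thesis using e by (auto simp: A_def intro!: generate.incl)
  qed
  have gen: "\<gamma> x d \<in> generate G A" if e: "(x, d) \<in> half_edges M" for x d
  proof (cases "snd d")
    case True
    then show ?thesis using pos_gen e by (simp add: edges_def)
  next
    case False
    note fl = half_edges_flip[OF M e] and V = half_edges_vertices[OF M e]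
      and dS = half_edges_letter[OF M e]
    have "(x #> lv d, flip d) \<in> edges M" using fl False by (simp add: edges_def)
    then have "\<gamma> (x #> lv d) (flip d) \<in> generate G A" by (rule pos_gen)
    then have "inv (\<gamma> (x #> lv d) (flip d)) \<in> generate G A" by (rule subgroup.m_inv_closed[OF gen_sub])
    moreover have "inv (\<gamma> (x #> lv d) (flip d)) = \<gamma> x d"
      unfolding \<gamma>_def fl(2) using tV(1)[OF V(1)] tV(1)[OF V(2)] dS
      by (simp add: lv_flip lv_closed inv_mult_group m_assoc)
    ultimately show ?thesis by simp
  qed
  have "h \<in> generate G A" if h: "h \<in> M" for h
  proof -
    have hc: "h \<in> carrier G" by (rule subgroup.mem_carrier[OF M h])
    have "wv p \<otimes> inv t (M #> wv p) \<in> generate G A" if "nf h = p @ r" for p r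
      using that
    proof (induction p arbitrary: r rule: rev_induct)
      case Nil
      then show ?case using t M generate.one[of G A] by (simp add: coset_mult_one subgroup.subset)
    next
      case (snoc d p)
      then have nfh: "nf h = p @ d # r" by simp
      note st = prefix_step[OF M h nfh] and e = half_edgesI[OF h nfh]
      let ?x = "M #> wv p"
      have V: "t ?x \<in> carrier G" "t (?x #> lv d) \<in> carrier G"
        using tV(1) half_edges_vertices[OF M e] by simp_all
      have "(wv p \<otimes> inv t ?x) \<otimes> \<gamma> ?x d \<in> generate G A"
        using snoc.IH[OF nfh] gen[OF e] by (rule generate.eng)
      moreover have "(wv p \<otimes> inv t ?x) \<otimes> \<gamma> ?x d = wv (p @ [d]) \<otimes> inv t (?x #> lv d)"
      proof -
        have "inv t ?x \<otimes> (t ?x \<otimes> (lv d \<otimes> inv t (?x #> lv d))) = lv d \<otimes> inv t (?x #> lv d)"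
          using V st by (simp add: m_assoc[symmetric] lv_closed)
        then show ?thesis using V st by (simp add: \<gamma>_def wv_append m_assoc lv_closed)
      qed
      ultimately show ?case by (simp only: st(3))
    qed
    from this[of "nf h" "[]"] show ?thesis using wv_nf[OF hc] h hc t M by simp
  qed
  then have "generate G A = M" using generate_subgroup_incl[OF AM M] by blast
  moreover have "card A \<le> card (edges M) - card F"
    unfolding A_def using card_image_le[of "edges M - F"] fin F
    by (metis card_Diff_subset finite_Diff finite_subset)
  moreover have "finite A" using fin by (simp add: A_def)
  moreover have "card F \<le> card (edges M)" using F fin by (simp add: card_mono)
  ultimately show ?thesis using AM F(2) by (intro exI[of _ A]) auto
qed

end

context free_evaluation begin

section \<open>Potentials of cochains\<close>

text \<open>A set \<open>c\<close> of edges of the core graph is a cochain with values in \<open>\<int>/2\<close>, pulled back here to the steps of the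
Cayley tree.\<close>

definition crosses :: "'a set \<Rightarrow> ('a set \<times> ('x \<times> bool)) set \<Rightarrow> 'a \<Rightarrow> 'x \<times> bool \<Rightarrow> bool" where
  "crosses H c v d \<longleftrightarrow> (if snd d then (H #> v, d) \<in> c else (H #> (v \<otimes> lv d), flip d) \<in> c)"

primrec crossing_parity :: "'a set \<Rightarrow> ('a set \<times> ('x \<times> bool)) set \<Rightarrow> 'a \<Rightarrow> 'x word \<Rightarrow> bool" where
  "crossing_parity H c v [] \<longleftrightarrow> False"
| "crossing_parity H c v (d # w) \<longleftrightarrow> crosses H c v d \<noteq> crossing_parity H c (v \<otimes> lv d) w"

definition potential :: "'a set \<Rightarrow> ('a set \<times> ('x \<times> bool)) set \<Rightarrow> 'a \<Rightarrow> bool" where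
  "potential H c g \<longleftrightarrow> crossing_parity H c \<one> (nf g)"

lemma crosses_flip:
  "v \<in> carrier G \<Longrightarrow> fst d \<in> S \<Longrightarrow> crosses H c (v \<otimes> lv d) (flip d) \<longleftrightarrow> crosses H c v d"
  by (simp add: crosses_def lv_flip lv_closed m_assoc)

lemma crossing_parity_append:
  "v \<in> carrier G \<Longrightarrow> on_S w \<Longrightarrow> on_S w' \<Longrightarrow>
    crossing_parity H c v (w @ w') \<longleftrightarrow> crossing_parity H c v w \<noteq> crossing_parity H c (v \<otimes> wv w) w'"
  by (induction w arbitrary: v) (auto simp: lv_closed m_assoc)

lemma crossing_parity_word_inverse:
  "v \<in> carrier G \<Longrightarrow> on_S w \<Longrightarrow>
    crossing_parity H c (v \<otimes> wv w) (word_inverse w) \<longleftrightarrow> crossing_parity H c v w"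
proof (induction w arbitrary: v)
  case (Cons d w)
  have S: "fst d \<in> S" "on_S w" using Cons.prems by auto
  let ?u = "v \<otimes> lv d"
  have u: "?u \<in> carrier G" using Cons.prems S by (simp add: lv_closed)
  have eq: "v \<otimes> wv (d # w) = ?u \<otimes> wv w" using Cons.prems S by (simp add: m_assoc lv_closed)
  have return: "?u \<otimes> wv w \<otimes> wv (word_inverse w) = ?u"
    using u S by (simp add: wv_word_inverse m_assoc)
  have "crossing_parity H c (?u \<otimes> wv w) (word_inverse w @ [flip d])
      \<longleftrightarrow> crossing_parity H c (?u \<otimes> wv w) (word_inverse w) \<noteq> crosses H c ?u (flip d)"
    using u S by (subst crossing_parity_append) (simp_all add: return)
  also have "\<dots> \<longleftrightarrow> crossing_parity H c ?u w \<noteq> crosses H c v d"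
    using Cons.IH[OF u S(2)] crosses_flip[OF Cons.prems(1) S(1)] by simp
  finally show ?case unfolding eq by auto
qed simp

text \<open>A step and its reverse cross the same edge, so cancellation does not change the parity.\<close>

lemma potential_mult:
  assumes "g \<in> carrier G" "h \<in> carrier G"
  shows "potential H c (g \<otimes> h) \<longleftrightarrow> potential H c g \<noteq> crossing_parity H c g (nf h)"
proof -
  obtain a q b where *: "nf g = a @ q" "nf h = word_inverse q @ b" "nf (g \<otimes> h) = a @ b"
    "on_S a" "on_S q" "on_S b" by (rule nf_mult[OF assms])
  have g: "g = wv a \<otimes> wv q" using wv_nf[OF assms(1)] * by (simp add: wv_append)
  have "crossing_parity H c g (nf h)
      \<longleftrightarrow> crossing_parity H c (wv a) q \<noteq> crossing_parity H c (g \<otimes> wv (word_inverse q)) b"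
    using * assms crossing_parity_word_inverse[of "wv a" q H c] g
    by (simp add: crossing_parity_append)
  moreover have "g \<otimes> wv (word_inverse q) = wv a" using g * by (simp add: wv_word_inverse m_assoc)
  ultimately show ?thesis using * by (auto simp: potential_def crossing_parity_append)
qed

lemma potential_step:
  "g \<in> carrier G \<Longrightarrow> fst d \<in> S \<Longrightarrow> potential H c (g \<otimes> lv d) \<longleftrightarrow> potential H c g \<noteq> crosses H c g d"
  using potential_mult[of g "lv d" H c] by (simp add: lv_closed nf_lv)

lemma crossing_parity_coset:
  assumes H: "subgroup H G" "h \<in> H"
  shows "v \<in> carrier G \<Longrightarrow> on_S w \<Longrightarrow> crossing_parity H c (h \<otimes> v) w \<longleftrightarrow> crossing_parity H c v w"
proof (induction w arbitrary: v)
  case (Cons d w)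
  have h: "h \<in> carrier G" by (rule subgroup.mem_carrier[OF H])
  have shift: "H #> (h \<otimes> u) = H #> u" if "u \<in> carrier G" for u
    using coset_mult_assoc[OF subgroup.subset[OF H(1)] h that] coset_mem[OF H] by simp
  have d: "lv d \<in> carrier G" using Cons.prems by (simp add: lv_closed)
  have "crosses H c (h \<otimes> v) d \<longleftrightarrow> crosses H c v d"
    using shift[of v] shift[of "v \<otimes> lv d"] Cons.prems h d by (simp add: crosses_def m_assoc)
  moreover have "h \<otimes> v \<otimes> lv d = h \<otimes> (v \<otimes> lv d)" using Cons.prems h d by (simp add: m_assoc)
  ultimately show ?case using Cons.IH[of "v \<otimes> lv d"] Cons.prems d by simp
qed simp

lemma potential_coset:
  assumes H: "subgroup H G" "h \<in> H" and g: "g \<in> carrier G"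
  shows "potential H c (h \<otimes> g) \<longleftrightarrow> potential H c h \<noteq> potential H c g"
proof -
  have h: "h \<in> carrier G" by (rule subgroup.mem_carrier[OF H])
  have "crossing_parity H c (h \<otimes> \<one>) (nf g) \<longleftrightarrow> crossing_parity H c \<one> (nf g)"
    using nf_on_S[OF g] by (intro crossing_parity_coset[OF H]) simp_all
  then show ?thesis using potential_mult[OF h g, of H c] h by (simp add: potential_def)
qed

text \<open>The potential of a cochain restricts to a homomorphism on \<open>H\<close>. Together with its values at representatives
of the vertices other than the base point, this homomorphism determines the potential on all the
vertices, and the cochain is the coboundary of its potential.\<close>

lemma card_edges_le_mod2_homs:
  assumes H: "subgroup H G" and fin: "finite (vertices H)" "finite (edges H)" "finite (mod2_homs G H)"
  shows "2 ^ card (edges H) \<le> card (mod2_homs G H) * 2 ^ (card (vertices H) - 1)"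
proof -
  have "\<forall>x\<in>vertices H. \<exists>v. v \<in> carrier G \<and> x = H #> v" using vertices_closed[OF H] by metis
  then obtain rep where rep: "\<And>x. x \<in> vertices H \<Longrightarrow> rep x \<in> carrier G \<and> x = H #> rep x"
    by metis
  let ?h = "\<lambda>c. {h \<in> H. potential H c h}"
  let ?p = "\<lambda>c. {x \<in> vertices H - {H}. potential H c (rep x)}"
  have homs: "?h c \<in> mod2_homs G H" for c
    using potential_coset[OF H] subgroup.m_closed[OF H] subgroup.mem_carrier[OF H]
    by (auto simp: mod2_homs_def)
  have repH: "rep H \<in> H"
    using rep[OF base_vertex[OF H]] rcos_self[OF _ H, of "rep H"] by auto
  have inj: "inj_on (\<lambda>c. (?h c, ?p c)) (Pow (edges H))"
  proof (rule inj_onI)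
    fix c c' assume c: "c \<in> Pow (edges H)" "c' \<in> Pow (edges H)" and eq: "(?h c, ?p c) = (?h c', ?p c')"
    have onH: "potential H c h = potential H c' h" if "h \<in> H" for h
      using eq that by auto
    have onrep: "potential H c (rep x) = potential H c' (rep x)" if "x \<in> vertices H" for x
    proof (cases "x = H")
      case True
      then show ?thesis using onH repH by simp
    next
      case False
      have "?p c = ?p c'" using eq by simp
      then show ?thesis using that False by blast
    qed
    have on: "potential H c v = potential H c' v" if v: "v \<in> carrier G" "H #> v \<in> vertices H" for v
    proof -
      let ?r = "rep (H #> v)"
      have r: "?r \<in> carrier G" "H #> v = H #> ?r" using rep[OF v(2)] by simp_all
      have h: "v \<otimes> inv ?r \<in> H" by (rule coset_eq_imp_mem[OF H v(1) r])
      have "v = (v \<otimes> inv ?r) \<otimes> ?r" using v r by (simp add: m_assoc)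
      then show ?thesis
        using potential_coset[OF H h r(1), of c] potential_coset[OF H h r(1), of c'] onH[OF h] onrep[OF v(2)]
        by simp
    qed
    have "e \<in> c \<longleftrightarrow> e \<in> c'" if e: "e \<in> edges H" for e
    proof -
      obtain x d where xd: "e = (x, d)" by (cases e)
      have he: "(x, d) \<in> half_edges H" "snd d" using e xd by (auto simp: edges_def)
      note V = half_edges_vertices[OF H he(1)] and d = half_edges_letter[OF H he(1)]
      have v: "rep x \<in> carrier G" "x = H #> rep x" using rep[OF V(1)] by simp_all
      let ?v = "rep x"
      have "potential H c (?v \<otimes> lv d) = potential H c' (?v \<otimes> lv d)"
        using V(2) v d coset_step[OF H v(1) d] by (intro on) (simp_all add: lv_closed)
      moreover have "potential H c ?v = potential H c' ?v" using onrep[OF V(1)] .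
      ultimately have "crosses H c ?v d = crosses H c' ?v d"
        using potential_step[OF v(1) d, of H c] potential_step[OF v(1) d, of H c'] by argo
      then show ?thesis using he(2) xd v(2) by (simp add: crosses_def)
    qed
    then show "c = c'" using c by blast
  qed
  have "card (Pow (edges H)) \<le> card (mod2_homs G H \<times> Pow (vertices H - {H}))"
    using fin by (intro card_inj_on_le[OF inj]) (auto simp: homs)
  then show ?thesis using fin H by (simp add: card_Pow card_cartesian_product)
qed

end

section \<open>Branchings of core graphs\<close>

context free_evaluation begin

definition directions :: "'a set \<Rightarrow> 'a set \<Rightarrow> ('x \<times> bool) set" where
  "directions H x = {d. (x, d) \<in> half_edges H}"

lemma half_edges_eq_Sigma: "subgroup H G \<Longrightarrow> half_edges H = Sigma (vertices H) (directions H)"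
  using half_edges_vertices(1) by (auto simp: directions_def)

lemma finite_directions: "finite (half_edges H) \<Longrightarrow> finite (directions H x)"
  by (rule finite_subset[of _ "snd ` half_edges H"]) (force simp: directions_def)+

text \<open>The path of an element of \<open>H\<close> has no backtracking, so it enters and leaves an intermediate vertex by
different half-edges. At the base point, use the first and the last step of the cyclically reduced word.\<close>

lemma two_directions:
  assumes H: "subgroup H G" and fin: "finite (half_edges H)"
    and g: "g \<in> H" "cyclically_reduced (nf g)" and x: "x \<in> vertices H"
  shows "2 \<le> card (directions H x)"
proof -
  have *: "\<exists>d e. d \<noteq> e \<and> d \<in> directions H x \<and> e \<in> directions H x"
  proof -
    obtain p h r where p: "x = H #> wv p" "h \<in> H" "nf h = p @ r" using x by (auto simp: vertices_def)
    have base: ?thesis if "x = H"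
    proof -
      have ne: "nf g \<noteq> []" "hd (nf g) \<noteq> flip (last (nf g))" using g by (auto simp: cyclically_reduced_def)
      have 1: "nf g = [] @ hd (nf g) # tl (nf g)" using ne by simp
      have 2: "nf g = butlast (nf g) @ last (nf g) # []" using ne by simp
      have "(H, hd (nf g)) \<in> half_edges H"
        using half_edgesI[OF g(1) 1] coset_mult_one[OF subgroup.subset[OF H]] by simp
      moreover have "(H, flip (last (nf g))) \<in> half_edges H"
        using half_edges_flip(1)[OF H half_edgesI[OF g(1) 2]] prefix_step(3)[OF H g(1) 2]
          wv_nf[OF subgroup.mem_carrier[OF H g(1)]] coset_mem[OF H g(1)] ne by simp
      ultimately show ?thesis using ne(2)
        by (intro exI[of _ "hd (nf g)"] exI[of _ "flip (last (nf g))"]) (simp add: that directions_def)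
    qed
    show ?thesis
    proof (cases "p = [] \<or> r = []")
      case True
      have "x = H"
      proof (cases "p = []")
        case True
        show ?thesis unfolding p(1) True using coset_mult_one[OF subgroup.subset[OF H]] by simp
      next
        case False
        then have "p = nf h" using True p(3) by simp
        then have "wv p = h" using wv_nf[OF subgroup.mem_carrier[OF H p(2)]] by simp
        then show ?thesis unfolding p(1) using coset_mem[OF H p(2)] by simp
      qed
      then show ?thesis by (rule base)
    next
      case False
      then obtain p' e d r' where pr: "p = p' @ [e]" "r = d # r'" by (metis list.exhaust rev_exhaust)
      have 1: "nf h = p @ d # r'" and 2: "nf h = p' @ e # d # r'" using p pr by simp_all
      have "(x, d) \<in> half_edges H" using half_edgesI[OF p(2) 1] p(1) by simp
      moreover have "(x, flip e) \<in> half_edges H"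
        using half_edges_flip(1)[OF H half_edgesI[OF p(2) 2]] prefix_step(3)[OF H p(2) 2] p(1) pr(1) by simp
      moreover have "p' @ e # d # r' \<in> reduced_words S"
        using nf_reduced[OF subgroup.mem_carrier[OF H p(2)]] 2 by simp
      then have "d \<noteq> flip e" by (simp add: reduced_words_append_iff reduced_words_Cons_iff)
      ultimately show ?thesis by (intro exI[of _ d] exI[of _ "flip e"]) (simp add: directions_def)
    qed
  qed
  then obtain d e where de: "d \<noteq> e" "{d, e} \<subseteq> directions H x" by blast
  have "card {d, e} \<le> card (directions H x)"
    by (rule card_mono[OF finite_directions[OF fin] de(2)])
  then show ?thesis using de(1) by simp
qed

text \<open>A vertex with \<open>k\<close> directions has \<open>k - 2\<close> inner ones, and the sum of all \<open>k\<close> is twice the number of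
edges.\<close>

lemma card_branchings:
  assumes H: "subgroup H G" and fin: "finite (half_edges H)" "finite (vertices H)"
    and g: "g \<in> H" "cyclically_reduced (nf g)" and \<kappa>: "inj_on \<kappa> (snd ` half_edges H)"
  shows "card (Sigma (vertices H) (\<lambda>x. inner (\<kappa> ` directions H x))) + 2 * card (vertices H) = 2 * card (edges H)"
proof -
  have c: "card (\<kappa> ` directions H x) = card (directions H x)" for x
    by (rule card_image, rule inj_on_subset[OF \<kappa>]) (force simp: directions_def)
  have fd: "finite (\<kappa> ` directions H x)" for x using finite_directions[OF fin(1)] by simp
  have "card (Sigma (vertices H) (\<lambda>x. inner (\<kappa> ` directions H x))) = (\<Sum>x\<in>vertices H. card (inner (\<kappa> ` directions H x)))"
    using fin fd by (intro card_SigmaI) (auto simp: inner_def)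
  moreover have "card (half_edges H) = (\<Sum>x\<in>vertices H. card (directions H x))"
    unfolding half_edges_eq_Sigma[OF H] using fin finite_directions[OF fin(1)] by (intro card_SigmaI) auto
  moreover have "(\<Sum>x\<in>vertices H. card (directions H x)) = (\<Sum>x\<in>vertices H. card (inner (\<kappa> ` directions H x)) + 2)"
    using two_directions[OF H fin(1) g] card_inner[OF fd] by (intro sum.cong refl) (simp add: c)
  moreover have "\<dots> = (\<Sum>x\<in>vertices H. card (inner (\<kappa> ` directions H x))) + 2 * card (vertices H)"
    by (simp only: sum.distrib sum_constant mult.commute of_nat_id)
  ultimately show ?thesis using card_half_edges[OF H fin(1)] by simp
qed

lemma coset_eqI:
  assumes H: "subgroup H G" and "u \<in> carrier G" "v \<in> carrier G" "u \<otimes> inv v \<in> H"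
  shows "H #> u = H #> v"
proof -
  have "H #> u = H #> ((u \<otimes> inv v) \<otimes> v)" using assms by (simp add: m_assoc)
  also have "\<dots> = (H #> (u \<otimes> inv v)) #> v"
    using assms(2,3) by (intro coset_mult_assoc[OF subgroup.subset[OF H], symmetric]) simp_all
  also have "\<dots> = H #> v" unfolding coset_mem[OF H assms(4)] ..
  finally show ?thesis .
qed

lemma coset_mono:
  assumes "subgroup M G" "subgroup H G" "M \<subseteq> H" "u \<in> carrier G" "v \<in> carrier G" "M #> u = M #> v"
  shows "H #> u = H #> v"
  using coset_eqI[OF assms(2,4,5)] coset_eq_imp_mem[OF assms(1,4,5,6)] assms(3) by blast

lemma core_mono:
  assumes M: "subgroup M G" and H: "subgroup H G" and sub: "M \<subseteq> H" and v: "v \<in> carrier G"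
  shows "M #> v \<in> vertices M \<Longrightarrow> H #> v \<in> vertices H"
    and "(M #> v, d) \<in> half_edges M \<Longrightarrow> (H #> v, d) \<in> half_edges H"
proof -
  assume "M #> v \<in> vertices M"
  then obtain p m r where p: "M #> v = M #> wv p" "m \<in> M" "nf m = p @ r" by (auto simp: vertices_def)
  have "on_S p" using nf_on_S[OF subgroup.mem_carrier[OF M p(2)]] p(3) by auto
  then have "H #> v = H #> wv p" using coset_mono[OF M H sub v _ p(1)] by simp
  then show "H #> v \<in> vertices H" using verticesI[OF _ p(3), of H] p(2) sub by auto
next
  assume "(M #> v, d) \<in> half_edges M"
  then obtain p m r where p: "M #> v = M #> wv p" "m \<in> M" "nf m = p @ d # r"
    unfolding half_edges_def by blast
  have "H #> v = H #> wv p" using coset_mono[OF M H sub v _ p(1)] prefix_step(1)[OF M p(2,3)] by simp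
  then show "(H #> v, d) \<in> half_edges H" using half_edgesI[OF _ p(3), of H] p(2) sub by auto
qed

text \<open>Giving the representatives of the cosets of \<open>L\<close> the value zero extends a homomorphism equivariantly to
all of \<open>G\<close>, that is, to a potential on the Cayley tree.\<close>

lemma extend_mod2_hom:
  assumes L: "subgroup L G"
  obtains F where "\<And>\<phi> l g. \<phi> \<in> mod2_homs G L \<Longrightarrow> l \<in> L \<Longrightarrow> g \<in> carrier G \<Longrightarrow>
     F \<phi> (l \<otimes> g) \<longleftrightarrow> (l \<in> \<phi>) \<noteq> F \<phi> g"
proof -
  define rep where "rep x = (SOME v. v \<in> carrier G \<and> x = L #> v)" for x
  have rep: "rep (L #> g) \<in> carrier G" "L #> g = L #> rep (L #> g)" if "g \<in> carrier G" for g
  proof -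
    have "g \<in> carrier G \<and> L #> g = L #> g" using that by simp
    then have "rep (L #> g) \<in> carrier G \<and> L #> g = L #> rep (L #> g)" unfolding rep_def by (rule someI)
    then show "rep (L #> g) \<in> carrier G" "L #> g = L #> rep (L #> g)" by blast+
  qed
  have "l \<otimes> g \<otimes> inv (rep (L #> (l \<otimes> g))) \<in> \<phi> \<longleftrightarrow> (l \<in> \<phi>) \<noteq> (g \<otimes> inv (rep (L #> g)) \<in> \<phi>)"
    if "\<phi> \<in> mod2_homs G L" "l \<in> L" "g \<in> carrier G" for \<phi> l g
  proof -
    have l: "l \<in> carrier G" by (rule subgroup.mem_carrier[OF L that(2)])
    have "L #> (l \<otimes> g) = L #> g"
      using coset_mult_assoc[OF subgroup.subset[OF L] l that(3)] coset_mem[OF L that(2)] by simp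
    moreover have "g \<otimes> inv (rep (L #> g)) \<in> L"
      by (rule coset_eq_imp_mem[OF L that(3) rep[OF that(3)]])
    ultimately show ?thesis
      using mod2_homsD(2)[OF that(1,2)] rep[OF that(3)] l that(3) by (simp add: m_assoc)
  qed
  then show ?thesis using that[of "\<lambda>\<phi> g. g \<otimes> inv (rep (L #> g)) \<in> \<phi>"] by blast
qed

end

section \<open>Gluing two core graphs along that of the intersection\<close>

locale subgroup_pair = free_evaluation G S lv for G (structure) and S :: "'x set" and lv +
  fixes H K :: "'a set" and g :: 'a
  assumes H: "subgroup H G" and K: "subgroup K G"
    and fin_H: "finite (half_edges H)" "finite (vertices H)"
    and fin_K: "finite (half_edges K)" "finite (vertices K)"
    and g: "g \<in> H" "g \<in> K" "cyclically_reduced (nf g)"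
begin

abbreviation "M \<equiv> H \<inter> K"
abbreviation "L \<equiv> generate G (H \<union> K)"

text \<open>The two core graphs are kept disjoint by a Boolean tag.\<close>

definition side :: "bool \<Rightarrow> 'a set" where "side b = (if b then H else K)"

definition nodes :: "(bool \<times> 'a set) set" where
  "nodes = (SIGMA b:UNIV. vertices (side b))"

definition dirs :: "bool \<times> 'a set \<Rightarrow> ('x \<times> bool) set" where
  "dirs z = directions (side (fst z)) (snd z)"

definition node_links :: "((bool \<times> 'a set) \<times> (bool \<times> 'a set)) set" where
  "node_links = {((True, H #> v), (False, K #> v)) |v. v \<in> carrier G \<and> M #> v \<in> vertices M}"

definition link_dirs :: "bool \<times> 'a set \<Rightarrow> bool \<times> 'a set \<Rightarrow> ('x \<times> bool) set" where
  "link_dirs x y = {d. \<exists>v\<in>carrier G. snd x = H #> v \<and> snd y = K #> v \<and> (M #> v, d) \<in> half_edges M}"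

definition opposite :: "(bool \<times> 'a set) \<times> ('x \<times> bool) \<Rightarrow> (bool \<times> 'a set) \<times> ('x \<times> bool)" where
  "opposite = (\<lambda>((b, x), d). ((b, x #> lv d), flip d))"

lemma M: "subgroup M G"
  using subgroups_Inter_pair[OF H K] .

lemma L: "subgroup L G"
  using generate_is_subgroup subgroup.subset[OF H] subgroup.subset[OF K] by simp

lemma side: "subgroup (side b) G" "finite (half_edges (side b))" "finite (vertices (side b))"
  "M \<subseteq> side b" "g \<in> side b" "side b \<subseteq> L"
  using H K fin_H fin_K g generate.incl[of _ "H \<union> K" G] by (auto simp: side_def)

lemma finite_nodes: "finite nodes"
  unfolding nodes_def using side(3) by (intro finite_SigmaI) auto

lemma finite_dirs: "finite (dirs z)"
  unfolding dirs_def using finite_directions side(2) by blast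

lemma M_coset_eqI:
  assumes "u \<in> carrier G" "v \<in> carrier G" "H #> u = H #> v" "K #> u = K #> v"
  shows "M #> u = M #> v"
  using coset_eqI[OF M assms(1,2)] coset_eq_imp_mem[OF H assms(1,2,3)] coset_eq_imp_mem[OF K assms(1,2,4)]
  by blast

text \<open>The vertices \<open>H #> v\<close> and \<open>K #> v\<close> together determine the coset \<open>M #> v\<close>, which is their intersection.\<close>

lemma link_dirs_eq:
  assumes v: "v \<in> carrier G"
  shows "link_dirs (b, H #> v) (c, K #> v) = directions M (M #> v)"
proof -
  have "(M #> v, d) \<in> half_edges M" if d: "d \<in> link_dirs (b, H #> v) (c, K #> v)" for d
  proof -
    obtain u where u: "u \<in> carrier G" "H #> v = H #> u" "K #> v = K #> u" "(M #> u, d) \<in> half_edges M"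
      using d unfolding link_dirs_def by auto
    show ?thesis using M_coset_eqI[OF v u(1-3)] u(4) by simp
  qed
  moreover have "d \<in> link_dirs (b, H #> v) (c, K #> v)" if "(M #> v, d) \<in> half_edges M" for d
    unfolding link_dirs_def using v that by auto
  ultimately show ?thesis unfolding directions_def by blast
qed

lemma node_linksE:
  assumes "(x, y) \<in> node_links"
  obtains v where "v \<in> carrier G" "x = (True, H #> v)" "y = (False, K #> v)" "M #> v \<in> vertices M"
    "link_dirs x y = directions M (M #> v)"
proof -
  obtain v where "v \<in> carrier G" "x = (True, H #> v)" "y = (False, K #> v)" "M #> v \<in> vertices M"
    using assms by (auto simp: node_links_def)
  then show ?thesis using that link_dirs_eq by blast
qed

lemma node_linksI: "v \<in> carrier G \<Longrightarrow> M #> v \<in> vertices M \<Longrightarrow> ((True, H #> v), (False, K #> v)) \<in> node_links"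
  unfolding node_links_def by blast

lemma side_simps [simp]: "side True = H" "side False = K"
  by (simp_all add: side_def)

lemma node_links_nodes: "node_links \<subseteq> nodes \<times> nodes"
proof
  fix e assume e: "e \<in> node_links"
  obtain x y where xy: "e = (x, y)" by (cases e)
  obtain v where v: "v \<in> carrier G" "x = (True, H #> v)" "y = (False, K #> v)" "M #> v \<in> vertices M"
    by (rule node_linksE[OF e[unfolded xy]])
  then show "e \<in> nodes \<times> nodes"
    using core_mono(1)[OF M H _ v(1,4)] core_mono(1)[OF M K _ v(1,4)] xy by (simp add: nodes_def)
qed

lemma link_dirs_subset:
  assumes "(x, y) \<in> node_links"
  shows "link_dirs x y \<subseteq> dirs x \<inter> dirs y"
proof -
  obtain v where v: "v \<in> carrier G" "x = (True, H #> v)" "y = (False, K #> v)"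
    "link_dirs x y = directions M (M #> v)" by (rule node_linksE[OF assms])
  show ?thesis
    unfolding v(4) using core_mono(2)[OF M H _ v(1)] core_mono(2)[OF M K _ v(1)] v(2,3)
    by (auto simp: dirs_def directions_def)
qed

lemma opposite_mem:
  assumes "e \<in> Sigma nodes dirs"
  shows "opposite e \<in> Sigma nodes dirs" "opposite (opposite e) = e" "snd (snd (opposite e)) \<longleftrightarrow> \<not> snd (snd e)"
proof -
  obtain b x d where e: "e = ((b, x), d)" by (metis surj_pair)
  have he: "(x, d) \<in> half_edges (side b)" using assms e by (auto simp: dirs_def directions_def)
  note fl = half_edges_flip[OF side(1) he] and V = half_edges_vertices[OF side(1) he]
  show "opposite e \<in> Sigma nodes dirs" "opposite (opposite e) = e" "snd (snd (opposite e)) \<longleftrightarrow> \<not> snd (snd e)"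
    using fl V e by (simp_all add: opposite_def nodes_def dirs_def directions_def)
qed

lemma opposite_link:
  assumes xy: "(x, y) \<in> node_links" and d: "d \<in> link_dirs x y"
  obtains x' y' where "opposite (x, d) = (x', flip d)" "opposite (y, d) = (y', flip d)"
    "(x', y') \<in> node_links" "flip d \<in> link_dirs x' y'"
proof -
  obtain v where v: "v \<in> carrier G" "x = (True, H #> v)" "y = (False, K #> v)"
    "link_dirs x y = directions M (M #> v)" by (rule node_linksE[OF xy])
  have he: "(M #> v, d) \<in> half_edges M" using d v(4) by (simp add: directions_def)
  have dS: "fst d \<in> S" by (rule half_edges_letter[OF M he])
  have w: "v \<otimes> lv d \<in> carrier G" using v dS by (simp add: lv_closed)
  note step = coset_step[OF H v(1) dS] coset_step[OF K v(1) dS] coset_step[OF M v(1) dS]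
  let ?x = "(True, H #> (v \<otimes> lv d))" and ?y = "(False, K #> (v \<otimes> lv d))"
  have "opposite (x, d) = (?x, flip d)" "opposite (y, d) = (?y, flip d)"
    using v(2,3) step by (simp_all add: opposite_def)
  moreover have "(?x, ?y) \<in> node_links"
    using half_edges_vertices(2)[OF M he] step(3) by (intro node_linksI[OF w]) simp
  moreover have "flip d \<in> link_dirs ?x ?y"
    using half_edges_flip(1)[OF M he] step(3) unfolding link_dirs_eq[OF w] directions_def by simp
  ultimately show ?thesis using that by blast
qed

abbreviation "half_edge_cochains \<equiv> invariant_sets (Sigma nodes dirs) (lift_links node_links link_dirs)"

abbreviation "positive_half_edges \<equiv> {e \<in> Sigma nodes dirs. snd (snd e)}"

text \<open>These are the cochains of the glued graph: pairs of cochains of the two core graphs with the same pullback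
to the core graph of \<open>M\<close>.\<close>

abbreviation "edge_cochains \<equiv> invariant_sets positive_half_edges
  (lift_links node_links (\<lambda>x y. {d \<in> link_dirs x y. snd d}))"

lemma finite_half_edge_set: "finite (Sigma nodes dirs)"
  using finite_nodes finite_dirs by simp

text \<open>Taking opposites exchanges positive and negative half-edges and respects the links, so an arbitrary
function on half-edges amounts to two functions on edges.\<close>

lemma card_edge_cochains: "(card edge_cochains)\<^sup>2 \<le> card half_edge_cochains"
proof -
  let ?f = "\<lambda>(a, b). {e \<in> Sigma nodes dirs. if snd (snd e) then e \<in> a else opposite e \<in> b}"
  have inv: "?f (a, b) \<in> half_edge_cochains" if a: "a \<in> edge_cochains" and b: "b \<in> edge_cochains" for a b
  proof (rule invariant_sets_liftI)
    show "?f (a, b) \<subseteq> Sigma nodes dirs" by auto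
    fix x y d assume xy: "(x, y) \<in> node_links" and d: "d \<in> link_dirs x y"
    have mem: "(x, d) \<in> Sigma nodes dirs" "(y, d) \<in> Sigma nodes dirs"
      using node_links_nodes xy link_dirs_subset[OF xy] d by auto
    show "(x, d) \<in> ?f (a, b) \<longleftrightarrow> (y, d) \<in> ?f (a, b)"
    proof (cases "snd d")
      case True
      then have "((x, d), (y, d)) \<in> lift_links node_links (\<lambda>x y. {d \<in> link_dirs x y. snd d})"
        using xy d by (intro lift_linksI) simp_all
      then have "(x, d) \<in> a \<longleftrightarrow> (y, d) \<in> a" by (rule invariant_setsD(2)[OF a])
      then show ?thesis using mem True by simp
    next
      case False
      obtain x' y' where o: "opposite (x, d) = (x', flip d)" "opposite (y, d) = (y', flip d)"
        "(x', y') \<in> node_links" "flip d \<in> link_dirs x' y'" by (rule opposite_link[OF xy d])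
      have "((x', flip d), (y', flip d)) \<in> lift_links node_links (\<lambda>x y. {d \<in> link_dirs x y. snd d})"
        using o(3,4) False by (intro lift_linksI) simp_all
      then have "(x', flip d) \<in> b \<longleftrightarrow> (y', flip d) \<in> b" by (rule invariant_setsD(2)[OF b])
      then show ?thesis using mem False o(1,2) by simp
    qed
  qed
  have inj: "inj_on ?f (edge_cochains \<times> edge_cochains)"
  proof (rule inj_onI)
    fix t t' assume t: "t \<in> edge_cochains \<times> edge_cochains" "t' \<in> edge_cochains \<times> edge_cochains"
      and eq: "?f t = ?f t'"
    obtain a b a' b' where ab: "t = (a, b)" "t' = (a', b')" by (cases t; cases t')
    have sub: "a \<subseteq> positive_half_edges" "b \<subseteq> positive_half_edges" "a' \<subseteq> positive_half_edges"
      "b' \<subseteq> positive_half_edges" using t ab by (auto dest!: invariant_setsD(1))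
    have eq': "e \<in> ?f (a, b) \<longleftrightarrow> e \<in> ?f (a', b')" for e using eq ab by simp
    have "e \<in> a \<longleftrightarrow> e \<in> a'" if "e \<in> positive_half_edges" for e
      using eq'[of e] that by simp
    then have "a = a'" using sub(1,3) by blast
    moreover have "e \<in> b \<longleftrightarrow> e \<in> b'" if "e \<in> positive_half_edges" for e
    proof -
      have e: "e \<in> Sigma nodes dirs" "snd (snd e)" using that by simp_all
      show ?thesis using eq'[of "opposite e"] opposite_mem[OF e(1)] e(2) by simp
    qed
    then have "b = b'" using sub(2,4) by blast
    ultimately show "t = t'" using ab by simp
  qed
  have image: "?f ` (edge_cochains \<times> edge_cochains) \<subseteq> half_edge_cochains"
  proof (rule image_subsetI)
    fix t assume "t \<in> edge_cochains \<times> edge_cochains"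
    then obtain a b where "t = (a, b)" "a \<in> edge_cochains" "b \<in> edge_cochains" by (rule SigmaE) auto
    then show "?f t \<in> half_edge_cochains" using inv by simp
  qed
  have "card (edge_cochains \<times> edge_cochains) \<le> card half_edge_cochains"
    using finite_half_edge_set by (intro card_inj_on_le[OF inj image]) simp
  then show ?thesis by (simp add: card_cartesian_product power2_eq_square)
qed

text \<open>A homomorphism \<open>\<phi>\<close> of \<open>L\<close>, extended to a potential on the tree, has a coboundary that is invariant under \<open>L\<close>, so
it defines a cochain of the glued graph. Add to it the coboundary of an invariant set \<open>p\<close> of
nodes. If \<open>(\<phi>, p)\<close> and \<open>(\<phi>', p')\<close> give the same cochain, the difference of the potentials plus that of
\<open>p\<close> and \<open>p'\<close> is constant along every path from the base point, which forces \<open>\<phi>\<close> and \<open>\<phi>'\<close> to agree on \<open>H\<close>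
and \<open>K\<close>; then \<open>p\<close> and \<open>p'\<close> can differ only by the constant, which is one of two values and is fixed by membership
of the base node.\<close>

lemma card_mod2_homs_join:
  "card (mod2_homs G L) * card (invariant_sets nodes node_links) \<le> 2 * card edge_cochains"
proof -
  obtain F where F: "\<And>\<phi> l g. \<phi> \<in> mod2_homs G L \<Longrightarrow> l \<in> L \<Longrightarrow> g \<in> carrier G \<Longrightarrow>
     F \<phi> (l \<otimes> g) \<longleftrightarrow> (l \<in> \<phi>) \<noteq> F \<phi> g"
    using extend_mod2_hom[OF L] by blast
  define jump where "jump \<phi> p b v d \<longleftrightarrow> (F \<phi> (v \<otimes> lv d) \<noteq> F \<phi> v) \<noteq>
      (((b, side b #> v) \<in> p) \<noteq> ((b, side b #> (v \<otimes> lv d)) \<in> p))" for \<phi> p b v d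
  define \<delta> where "\<delta> \<phi> p = {e \<in> positive_half_edges. \<exists>v\<in>carrier G.
      snd (fst e) = side (fst (fst e)) #> v \<and> jump \<phi> p (fst (fst e)) v (snd e)}" for \<phi> p
  have jump_cong: "jump \<phi> p b u d \<longleftrightarrow> jump \<phi> p b v d"
    if \<phi>: "\<phi> \<in> mod2_homs G L" and uv: "u \<in> carrier G" "v \<in> carrier G" "side b #> u = side b #> v" and d: "fst d \<in> S"
    for \<phi> p b u v d
  proof -
    have l: "u \<otimes> inv v \<in> L" using coset_eq_imp_mem[OF side(1) uv] side(6) by blast
    have u: "u = (u \<otimes> inv v) \<otimes> v" using uv by (simp add: m_assoc)
    also have "\<dots> \<otimes> lv d = (u \<otimes> inv v) \<otimes> (v \<otimes> lv d)"
      using uv d by (intro m_assoc) (simp_all add: lv_closed)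
    finally have ud: "u \<otimes> lv d = (u \<otimes> inv v) \<otimes> (v \<otimes> lv d)" .
    have st: "side b #> (u \<otimes> lv d) = side b #> (v \<otimes> lv d)"
      using coset_step[OF side(1)[of b] uv(1) d] coset_step[OF side(1)[of b] uv(2) d] uv(3) by simp
    have "F \<phi> u \<longleftrightarrow> (u \<otimes> inv v \<in> \<phi>) \<noteq> F \<phi> v"
      using F[OF \<phi> l uv(2)] u by simp
    moreover have "F \<phi> (u \<otimes> lv d) \<longleftrightarrow> (u \<otimes> inv v \<in> \<phi>) \<noteq> F \<phi> (v \<otimes> lv d)"
      using F[OF \<phi> l, of "v \<otimes> lv d"] ud uv(2) d by (simp add: lv_closed)
    ultimately show ?thesis unfolding jump_def uv(3) st by argo
  qed
  have letter: "fst d \<in> S" if "((b, x), d) \<in> Sigma nodes dirs" for b x d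
    using half_edges_letter[OF side(1)[of b], of x d] that by (simp add: dirs_def directions_def)
  have \<delta>_iff: "((b, side b #> v), d) \<in> \<delta> \<phi> p \<longleftrightarrow> jump \<phi> p b v d"
    if "\<phi> \<in> mod2_homs G L" "v \<in> carrier G" "((b, side b #> v), d) \<in> positive_half_edges" for \<phi> p b v d
  proof -
    have dS: "fst d \<in> S" using letter[of b "side b #> v" d] that(3) by simp
    have "((b, side b #> v), d) \<in> \<delta> \<phi> p \<longleftrightarrow> (\<exists>u\<in>carrier G. side b #> v = side b #> u \<and> jump \<phi> p b u d)"
      using that(3) by (simp add: \<delta>_def)
    also have "\<dots> \<longleftrightarrow> jump \<phi> p b v d"
      using jump_cong[OF that(1) _ that(2) _ dS, of _ b p] that(2) by metis
    finally show ?thesis .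
  qed
  have cochain: "\<delta> \<phi> p \<in> edge_cochains"
    if \<phi>: "\<phi> \<in> mod2_homs G L" and p: "p \<in> invariant_sets nodes node_links" for \<phi> p
  proof (rule invariant_sets_liftI)
    show "\<delta> \<phi> p \<subseteq> positive_half_edges" by (auto simp: \<delta>_def)
    fix x y d assume xy: "(x, y) \<in> node_links" and d: "d \<in> {d \<in> link_dirs x y. snd d}"
    obtain v where v: "v \<in> carrier G" "x = (True, H #> v)" "y = (False, K #> v)"
      "link_dirs x y = directions M (M #> v)" by (rule node_linksE[OF xy])
    have mem: "(x, d) \<in> positive_half_edges" "(y, d) \<in> positive_half_edges"
      using node_links_nodes xy link_dirs_subset[OF xy] d by auto
    have he: "(M #> v, d) \<in> half_edges M" using d v(4) by (simp add: directions_def)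
    have dS: "fst d \<in> S" by (rule half_edges_letter[OF M he])
    have w: "v \<otimes> lv d \<in> carrier G" using v dS by (simp add: lv_closed)
    have "((True, H #> (v \<otimes> lv d)), (False, K #> (v \<otimes> lv d))) \<in> node_links"
      using half_edges_vertices(2)[OF M he] coset_step[OF M v(1) dS] by (intro node_linksI[OF w]) simp
    then have "(True, H #> (v \<otimes> lv d)) \<in> p \<longleftrightarrow> (False, K #> (v \<otimes> lv d)) \<in> p"
      by (rule invariant_setsD(2)[OF p])
    moreover have "(True, H #> v) \<in> p \<longleftrightarrow> (False, K #> v) \<in> p"
      using invariant_setsD(2)[OF p xy] v by simp
    ultimately have "jump \<phi> p True v d \<longleftrightarrow> jump \<phi> p False v d" by (simp add: jump_def)
    then show "(x, d) \<in> \<delta> \<phi> p \<longleftrightarrow> (y, d) \<in> \<delta> \<phi> p"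
      using \<delta>_iff[OF \<phi> v(1), of True d p] \<delta>_iff[OF \<phi> v(1), of False d p] mem v by simp
  qed
  let ?\<Phi> = "\<lambda>(\<phi>, p). ((True, H) \<in> p, \<delta> \<phi> p)"
  have inj: "inj_on ?\<Phi> (mod2_homs G L \<times> invariant_sets nodes node_links)"
  proof (rule inj_onI)
    fix t t' assume t: "t \<in> mod2_homs G L \<times> invariant_sets nodes node_links"
      "t' \<in> mod2_homs G L \<times> invariant_sets nodes node_links" and eq: "?\<Phi> t = ?\<Phi> t'"
    obtain \<phi> p \<phi>' p' where tp: "t = (\<phi>, p)" "t' = (\<phi>', p')" by (cases t; cases t')
    have \<phi>: "\<phi> \<in> mod2_homs G L" "\<phi>' \<in> mod2_homs G L" and p: "p \<in> invariant_sets nodes node_links"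
      "p' \<in> invariant_sets nodes node_links" using t tp by simp_all
    have base: "(True, H) \<in> p \<longleftrightarrow> (True, H) \<in> p'" and \<delta>: "\<delta> \<phi> p = \<delta> \<phi>' p'" using eq tp by simp_all
    have jump_eq: "jump \<phi> p b v d \<longleftrightarrow> jump \<phi>' p' b v d"
      if v: "v \<in> carrier G" and e: "((b, side b #> v), d) \<in> Sigma nodes dirs" for b v d
    proof (cases "snd d")
      case True
      then show ?thesis using \<delta>_iff[OF \<phi>(1) v, of b d p] \<delta>_iff[OF \<phi>(2) v, of b d p'] \<delta> e by simp
    next
      case False
      have dS: "fst d \<in> S" by (rule letter[OF e])
      let ?w = "v \<otimes> lv d"
      have w: "?w \<in> carrier G" "?w \<otimes> lv (flip d) = v"
        using v dS by (simp_all add: lv_closed lv_flip m_assoc)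
      have swap: "jump \<psi> q b ?w (flip d) \<longleftrightarrow> jump \<psi> q b v d" for \<psi> q
        unfolding jump_def w(2) by argo
      have "((b, side b #> ?w), flip d) \<in> positive_half_edges"
        using opposite_mem[OF e] False coset_step[OF side(1) v dS] by (simp add: opposite_def)
      then show ?thesis
        using \<delta>_iff[OF \<phi>(1) w(1), of b "flip d" p] \<delta>_iff[OF \<phi>(2) w(1), of b "flip d" p'] \<delta> swap by simp
    qed
    define k where "k b v \<longleftrightarrow> (F \<phi> v \<noteq> F \<phi>' v) \<noteq> (((b, side b #> v) \<in> p) \<noteq> ((b, side b #> v) \<in> p'))" for b v
    have const: "k b (wv q) \<longleftrightarrow> k b \<one>" if h: "h \<in> side b" and q: "nf h = q @ r" for b h q r
      using q
    proof (induction q arbitrary: r rule: rev_induct)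
      case (snoc d q)
      then have nfh: "nf h = q @ d # r" by simp
      note st = prefix_step[OF side(1) h nfh] and e = half_edgesI[OF h nfh]
      have "((b, side b #> wv q), d) \<in> Sigma nodes dirs"
        using e half_edges_vertices(1)[OF side(1) e] by (simp add: nodes_def dirs_def directions_def)
      then have "jump \<phi> p b (wv q) d \<longleftrightarrow> jump \<phi>' p' b (wv q) d" using st(1) by (intro jump_eq) simp_all
      then have "k b (wv q \<otimes> lv d) \<longleftrightarrow> k b (wv q)" unfolding jump_def k_def by argo
      moreover have "wv (q @ [d]) = wv q \<otimes> lv d" using st by (simp add: wv_append lv_closed)
      ultimately show ?case using snoc.IH[OF nfh] by simp
    qed simp
    have agree: "h \<in> \<phi> \<longleftrightarrow> h \<in> \<phi>'" if h: "h \<in> side b" for h b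
    proof -
      have hc: "h \<in> carrier G" by (rule subgroup.mem_carrier[OF side(1) h])
      have hL: "h \<in> L" using h side(6) by blast
      have "k b h \<longleftrightarrow> k b \<one>" using const[OF h, of "nf h" "[]"] wv_nf[OF hc] by simp
      moreover have co: "side b #> h = side b #> \<one>"
        using coset_mem[OF side(1) h] coset_mem[OF side(1) subgroup.one_closed[OF side(1)]] by simp
      moreover have "F \<phi> h \<longleftrightarrow> (h \<in> \<phi>) \<noteq> F \<phi> \<one>" "F \<phi>' h \<longleftrightarrow> (h \<in> \<phi>') \<noteq> F \<phi>' \<one>"
        using F[OF \<phi>(1) hL, of \<one>] F[OF \<phi>(2) hL, of \<one>] hc by simp_all
      ultimately show ?thesis unfolding k_def co by (simp; blast)
    qed
    have \<phi>_eq: "\<phi> = \<phi>'"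
      using agree[of _ True] agree[of _ False] by (intro mod2_homs_eqI[OF L refl \<phi>]) auto
    have "((True, H), (False, K)) \<in> node_links"
      using node_linksI[of \<one>] base_vertex[OF M] H K M by (simp add: coset_mult_one subgroup.subset)
    then have "(False, K) \<in> p \<longleftrightarrow> (False, K) \<in> p'"
      using base invariant_setsD(2)[OF p(1)] invariant_setsD(2)[OF p(2)] by blast
    then have k1: "\<not> k b \<one>" for b
      using base H K unfolding k_def \<phi>_eq by (cases b) (simp_all add: coset_mult_one subgroup.subset)
    have "z \<in> p \<longleftrightarrow> z \<in> p'" if "z \<in> nodes" for z
    proof -
      obtain b x where z: "z = (b, x)" by (cases z)
      then have "x \<in> vertices (side b)" using that by (simp add: nodes_def)
      then obtain q h r where q: "x = side b #> wv q" "h \<in> side b" "nf h = q @ r"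
        unfolding vertices_def by blast
      have "\<not> k b (wv q)" using const[OF q(2,3)] k1 by simp
      then show ?thesis unfolding k_def \<phi>_eq z q(1) by simp
    qed
    then have "p = p'" using invariant_setsD(1)[OF p(1)] invariant_setsD(1)[OF p(2)] by blast
    then show "t = t'" using tp \<phi>_eq by simp
  qed
  have "finite edge_cochains" using finite_half_edge_set by simp
  then have "card (mod2_homs G L \<times> invariant_sets nodes node_links) \<le> card ((UNIV :: bool set) \<times> edge_cochains)"
    using cochain by (intro card_inj_on_le[OF inj]) auto
  then show ?thesis by (simp add: card_cartesian_product)
qed

end

section \<open>The rank of the join\<close>

context free_evaluation begin

lemma card_edges_le_generators:
  assumes H: "subgroup H G" and fin: "finite (half_edges H)" "finite (vertices H)"
    and A: "finite A" "generate G A = H"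
  shows "card (edges H) + 1 \<le> card (vertices H) + card A"
proof -
  have pos: "0 < card (vertices H)" using fin base_vertex[OF H] by (auto simp: card_gt_0_iff)
  have "2 ^ card (edges H) \<le> card (mod2_homs G H) * 2 ^ (card (vertices H) - 1)"
    using card_mod2_homs_le(1)[OF H A(2,1)] fin finite_subset[OF edges_subset]
    by (intro card_edges_le_mod2_homs[OF H]) auto
  also have "\<dots> \<le> 2 ^ card A * 2 ^ (card (vertices H) - 1)"
    using card_mod2_homs_le(2)[OF H A(2,1)] by (rule mult_right_mono) simp
  finally have "(2::nat) ^ card (edges H) \<le> 2 ^ (card A + (card (vertices H) - 1))"
    by (simp add: power_add)
  then have "card (edges H) \<le> card A + (card (vertices H) - 1)" by (simp add: power_increasing_iff)
  then show ?thesis using pos by linarith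
qed

text \<open>Moving the base point of the Cayley tree to \<open>u\<close> amounts to conjugating the values of all words by \<open>u\<close>.\<close>

lemma conjugate_evaluation:
  assumes u: "u \<in> carrier G"
  shows "free_evaluation G S (\<lambda>d. u \<otimes> lv d \<otimes> inv u)"
    and "on_S w \<Longrightarrow> foldr (\<lambda>d g. (u \<otimes> lv d \<otimes> inv u) \<otimes> g) w \<one> = u \<otimes> wv w \<otimes> inv u"
proof -
  let ?lv = "\<lambda>d. u \<otimes> lv d \<otimes> inv u"
  have eval_conj: "foldr (\<lambda>d g. ?lv d \<otimes> g) w \<one> = u \<otimes> wv w \<otimes> inv u" if "on_S w" for w
    using that
  proof (induction w)
    case (Cons d w)
    have S: "lv d \<in> carrier G" "wv w \<in> carrier G" using Cons.prems by (simp_all add: lv_closed)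
    have "inv u \<otimes> (u \<otimes> (wv w \<otimes> inv u)) = wv w \<otimes> inv u"
      using u S by (simp add: m_assoc[symmetric])
    then show ?case using Cons u S by (simp add: m_assoc)
  qed (use u in simp)
  then show "on_S w \<Longrightarrow> foldr (\<lambda>d g. ?lv d \<otimes> g) w \<one> = u \<otimes> wv w \<otimes> inv u" .
  have cancel: "inv u \<otimes> (u \<otimes> x) = x" "u \<otimes> (inv u \<otimes> x) = x" if "x \<in> carrier G" for x
    using u that by (simp_all add: m_assoc[symmetric])
  have conj: "bij_betw (\<lambda>g. u \<otimes> g \<otimes> inv u) (carrier G) (carrier G)"
    by (rule bij_betw_byWitness[where f' = "\<lambda>g. inv u \<otimes> g \<otimes> u"])
      (use u in \<open>auto simp: m_assoc cancel\<close>)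
  have "bij_betw ((\<lambda>g. u \<otimes> g \<otimes> inv u) \<circ> wv) (reduced_words S) (carrier G)"
    using bij_betw_trans[OF bij conj] unfolding wv_def by (simp add: comp_def)
  then have bij': "bij_betw (\<lambda>w. foldr (\<lambda>d g. ?lv d \<otimes> g) w \<one>) (reduced_words S) (carrier G)"
    by (rule bij_betw_cong[THEN iffD1, rotated]) (simp add: eval_conj reduced_on_S)
  show "free_evaluation G S ?lv"
  proof (unfold_locales)
    fix d :: "'x \<times> bool" assume d: "fst d \<in> S"
    show "?lv d \<in> carrier G" using d u by (simp add: lv_closed)
    show "?lv (flip d) = inv (?lv d)" using d u by (simp add: lv_closed lv_flip inv_mult_group m_assoc)
  qed (rule bij')
qed

end

context subgroup_pair begin

lemma coset_Int: "v \<in> carrier G \<Longrightarrow> (H #> v) \<inter> (K #> v) = M #> v"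
  using subgroup.mem_carrier[OF H] subgroup.mem_carrier[OF K] by (auto simp: r_coset_def)

lemma finite_M: "finite (vertices M)" "finite (half_edges M)"
proof -
  have "vertices M \<subseteq> (\<lambda>(a, b). a \<inter> b) ` (vertices H \<times> vertices K)"
  proof
    fix x assume x: "x \<in> vertices M"
    obtain v where v: "v \<in> carrier G" "x = M #> v" by (rule vertices_closed[OF M x])
    have "(H #> v, K #> v) \<in> vertices H \<times> vertices K"
      using core_mono(1)[OF M H _ v(1)] core_mono(1)[OF M K _ v(1)] x v(2) by simp
    moreover have "x = (\<lambda>(a, b). a \<inter> b) (H #> v, K #> v)" using coset_Int[OF v(1)] v(2) by simp
    ultimately show "x \<in> (\<lambda>(a, b). a \<inter> b) ` (vertices H \<times> vertices K)" by (rule rev_image_eqI)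
  qed
  then show V: "finite (vertices M)" by (rule finite_subset) (use fin_H fin_K in simp)
  have "half_edges M \<subseteq> vertices M \<times> snd ` half_edges H"
  proof
    fix e assume e: "e \<in> half_edges M"
    obtain x d where xd: "e = (x, d)" by (cases e)
    have x: "x \<in> vertices M" using half_edges_vertices(1)[OF M] e xd by simp
    obtain v where v: "v \<in> carrier G" "x = M #> v" by (rule vertices_closed[OF M x])
    have "(H #> v, d) \<in> half_edges H" using core_mono(2)[OF M H _ v(1)] e xd v(2) by simp
    then show "e \<in> vertices M \<times> snd ` half_edges H" using x xd by force
  qed
  then show "finite (half_edges M)" by (rule finite_subset) (use V fin_H(1) in simp)
qed

text \<open>The letters that occur are finitely many, and an injection into the natural numbers orders the
directions at all vertices simultaneously, as the gluing requires. The bounds on branchings then combine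
with the inequalities for the glued graph.\<close>

lemma rank_join_le_3:
  assumes AH: "finite AH" "generate G AH = H" "card AH \<le> 3"
    and AK: "finite AK" "generate G AK = K" "card AK \<le> 3"
    and rank_M: "\<And>A. finite A \<Longrightarrow> A \<subseteq> M \<Longrightarrow> generate G A = M \<Longrightarrow> 3 \<le> card A"
  shows "\<exists>A. finite A \<and> A \<subseteq> L \<and> generate G A = L \<and> card A \<le> 3"
proof -
  have "finite (snd ` half_edges H \<union> snd ` half_edges K)" using fin_H fin_K by simp
  then obtain \<kappa> :: "'x \<times> bool \<Rightarrow> nat" where \<kappa>: "inj_on \<kappa> (snd ` half_edges H \<union> snd ` half_edges K)"
    using finite_imp_inj_to_nat_seg[of "snd ` half_edges H \<union> snd ` half_edges K"] by auto
  have \<kappa>H: "inj_on \<kappa> (snd ` half_edges H)" and \<kappa>K: "inj_on \<kappa> (snd ` half_edges K)"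
    by (rule inj_on_subset[OF \<kappa>]; blast)+
  have dirs_sub: "dirs z \<subseteq> snd ` half_edges H \<union> snd ` half_edges K" for z
    by (cases "fst z") (force simp: dirs_def directions_def)+
  have \<kappa>_dirs: "inj_on \<kappa> (dirs z)" for z by (rule inj_on_subset[OF \<kappa> dirs_sub])
  have "snd ` half_edges M \<subseteq> snd ` half_edges H"
  proof
    fix d assume "d \<in> snd ` half_edges M"
    then obtain x where e: "(x, d) \<in> half_edges M" by force
    obtain v where v: "v \<in> carrier G" "x = M #> v"
      by (rule vertices_closed[OF M half_edges_vertices(1)[OF M e]])
    have "(H #> v, d) \<in> half_edges H" using core_mono(2)[OF M H _ v(1)] e v(2) by simp
    then show "d \<in> snd ` half_edges H" by force
  qed
  then have \<kappa>M: "inj_on \<kappa> (snd ` half_edges M)" by (rule inj_on_subset[OF \<kappa>H])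
  have gM: "g \<in> M" using g by simp

  interpret LS: link_system nodes node_links "\<lambda>z. \<kappa> ` dirs z" "\<lambda>x y. \<kappa> ` link_dirs x y"
  proof
    show "finite nodes" by (rule finite_nodes)
    show "node_links \<subseteq> nodes \<times> nodes" by (rule node_links_nodes)
    fix z assume z: "z \<in> nodes"
    show "finite (\<kappa> ` dirs z)" using finite_dirs by simp
    have "2 \<le> card (dirs z)"
      using z two_directions[OF side(1,2,5) g(3)] by (auto simp: nodes_def dirs_def)
    then show "2 \<le> card (\<kappa> ` dirs z)" using card_image[OF \<kappa>_dirs] by simp
  next
    fix x y assume xy: "(x, y) \<in> node_links"
    show "\<kappa> ` link_dirs x y \<subseteq> \<kappa> ` dirs x \<inter> \<kappa> ` dirs y" using link_dirs_subset[OF xy] by blast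
    obtain v where v: "M #> v \<in> vertices M" "link_dirs x y = directions M (M #> v)"
      by (rule node_linksE[OF xy])
    have "2 \<le> card (link_dirs x y)"
      unfolding v(2) by (rule two_directions[OF M finite_M(2) gM g(3) v(1)])
    moreover have "inj_on \<kappa> (link_dirs x y)"
      by (rule inj_on_subset[OF \<kappa>_dirs[of x]]) (use link_dirs_subset[OF xy] in blast)
    ultimately show "2 \<le> card (\<kappa> ` link_dirs x y)" using card_image by fastforce
  qed

  have legs: "card LS.legs = card half_edge_cochains"
  proof -
    let ?g = "\<lambda>(z, d). (z, \<kappa> d)"
    have inj: "inj_on ?g (Sigma nodes dirs)"
    proof (rule inj_onI)
      fix e e' assume e: "e \<in> Sigma nodes dirs" "e' \<in> Sigma nodes dirs" "?g e = ?g e'"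
      obtain z d z' d' where eq: "e = (z, d)" "e' = (z', d')" by (cases e; cases e')
      then have "z = z'" "\<kappa> d = \<kappa> d'" "d \<in> dirs z" "d' \<in> dirs z" using e by auto
      then show "e = e'" using inj_onD[OF \<kappa>_dirs] eq by blast
    qed
    have sub: "lift_links node_links link_dirs \<subseteq> Sigma nodes dirs \<times> Sigma nodes dirs"
      using node_links_nodes link_dirs_subset unfolding lift_links_def by blast
    have "?g ` Sigma nodes dirs = Sigma nodes (\<lambda>z. \<kappa> ` dirs z)"
      by (auto simp: image_iff)
    moreover have "map_prod ?g ?g ` lift_links node_links link_dirs = lift_links node_links (\<lambda>x y. \<kappa> ` link_dirs x y)"
    proof (intro equalityI subsetI)
      fix e assume "e \<in> map_prod ?g ?g ` lift_links node_links link_dirs"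
      then obtain x y d where "(x, y) \<in> node_links" "d \<in> link_dirs x y" "e = ((x, \<kappa> d), (y, \<kappa> d))"
        unfolding lift_links_def by auto
      then show "e \<in> lift_links node_links (\<lambda>x y. \<kappa> ` link_dirs x y)" unfolding lift_links_def by blast
    next
      fix e assume "e \<in> lift_links node_links (\<lambda>x y. \<kappa> ` link_dirs x y)"
      then obtain x y d where *: "(x, y) \<in> node_links" "d \<in> link_dirs x y" "e = ((x, \<kappa> d), (y, \<kappa> d))"
        unfolding lift_links_def by blast
      have "e = map_prod ?g ?g ((x, d), (y, d))" using *(3) by simp
      then show "e \<in> map_prod ?g ?g ` lift_links node_links link_dirs"
        using lift_linksI[of x y node_links d link_dirs, OF *(1,2)] by (rule image_eqI)
    qed
    ultimately show ?thesis using card_invariant_sets_image[OF inj sub] by simp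
  qed

  \<comment> \<open>The branchings of the core graph of \<open>N\<close>.\<close>
  define T where "T N = Sigma (vertices N) (\<lambda>x. inner (\<kappa> ` directions N x))" for N
  have fin_T: "finite (T N)" if "finite (vertices N)" "finite (half_edges N)" for N
    unfolding T_def using that finite_directions[OF that(2)] by (auto simp: inner_def)
  have T_H: "card (T H) \<le> 4"
    using card_branchings[OF H fin_H g(1,3) \<kappa>H] card_edges_le_generators[OF H fin_H AH(1,2)] AH(3)
    unfolding T_def by linarith
  have T_K: "card (T K) \<le> 4"
    using card_branchings[OF K fin_K g(2,3) \<kappa>K] card_edges_le_generators[OF K fin_K AK(1,2)] AK(3)
    unfolding T_def by linarith
  have T_M: "4 \<le> card (T M)"
  proof -
    have "finite (edges M)" by (rule finite_subset[OF edges_subset finite_M(2)])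
    then obtain A where "finite A" "A \<subseteq> M" "generate G A = M" "card A + card (vertices M) \<le> Suc (card (edges M))"
      using generators_of_core[OF M finite_M(1)] by blast
    then show ?thesis
      using rank_M[of A] card_branchings[OF M finite_M(2,1) gM g(3) \<kappa>M] unfolding T_def by linarith
  qed
  let ?P = "\<lambda>b. (\<lambda>(x, i). ((b, x), i)) ` T (side b)"
  let ?R = "lift_links node_links (\<lambda>x y. inner (\<kappa> ` link_dirs x y))"
  have R_sub: "?R \<subseteq> ?P True \<times> ?P False"
  proof
    fix e assume "e \<in> ?R"
    then obtain x y i where e: "e = ((x, i), (y, i))" "(x, y) \<in> node_links" "i \<in> inner (\<kappa> ` link_dirs x y)"
      unfolding lift_links_def by blast
    obtain v where v: "x = (True, H #> v)" "y = (False, K #> v)" by (rule node_linksE[OF e(2)])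
    have "x \<in> nodes" "y \<in> nodes" using node_links_nodes e(2) by auto
    then show "e \<in> ?P True \<times> ?P False"
      using LS.inner_E[OF e(2,3)] v e(1) by (auto simp: T_def nodes_def dirs_def image_iff)
  qed
  have fin_P: "finite (?P b)" for b using fin_T[OF side(3,2)] by simp
  \<comment> \<open>Intersecting the two cosets recovers the branching of \<open>M\<close> from its link.\<close>
  have T_R: "T M \<subseteq> (\<lambda>(((b, x), i), ((c, y), j)). (x \<inter> y, i)) ` ?R"
  proof
    fix e assume "e \<in> T M"
    then obtain x i where e: "e = (x, i)" "x \<in> vertices M" "i \<in> inner (\<kappa> ` directions M x)"
      by (auto simp: T_def)
    obtain v where v: "v \<in> carrier G" "x = M #> v" by (rule vertices_closed[OF M e(2)])
    have "((True, H #> v), (False, K #> v)) \<in> node_links" using node_linksI v e(2) by simp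
    moreover have "i \<in> inner (\<kappa> ` link_dirs (True, H #> v) (False, K #> v))"
      using e(3) v link_dirs_eq[OF v(1)] by simp
    ultimately have "(((True, H #> v), i), ((False, K #> v), i)) \<in> ?R" by (rule lift_linksI)
    moreover have "e = (\<lambda>(((b, x), i), ((c, y), j)). (x \<inter> y, i)) (((True, H #> v), i), ((False, K #> v), i))"
      using e(1) v coset_Int[OF v(1)] by simp
    ultimately show "e \<in> (\<lambda>(((b, x), i), ((c, y), j)). (x \<inter> y, i)) ` ?R" by (rule rev_image_eqI)
  qed
  have fin_R: "finite ?R" using fin_P[of True] fin_P[of False] by (intro finite_subset[OF R_sub]) simp
  have four: "4 \<le> card ?R" using T_M surj_card_le[OF fin_R T_R] by simp
  have "Sigma nodes (\<lambda>z. inner (\<kappa> ` dirs z)) = ?P True \<union> ?P False"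
  proof -
    have branch: "((b, x), i) \<in> Sigma nodes (\<lambda>z. inner (\<kappa> ` dirs z)) \<longleftrightarrow> ((b, x), i) \<in> ?P True \<union> ?P False" for b x i
      by (cases b) (auto simp: nodes_def dirs_def T_def image_iff)
    show ?thesis
    proof (rule Set.set_eqI)
      fix e :: "(bool \<times> 'a set) \<times> nat"
      obtain b x i where e: "e = ((b, x), i)" by (metis surj_pair)
      show "e \<in> Sigma nodes (\<lambda>z. inner (\<kappa> ` dirs z)) \<longleftrightarrow> e \<in> ?P True \<union> ?P False"
        unfolding e by (rule branch)
    qed
  qed
  then have "card LS.inner_legs \<le> 2 ^ (card (?P True) + card (?P False) - 3)"
    using card_invariant_sets_bipartite[OF fin_P fin_P _ R_sub four] by fastforce
  also have "\<dots> \<le> 2 ^ 5"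
  proof (rule power_increasing)
    have "card (?P True) \<le> card (T H)" "card (?P False) \<le> card (T K)"
      using card_image_le[OF fin_T[OF side(3,2)], of _ True] card_image_le[OF fin_T[OF side(3,2)], of _ False]
      by simp_all
    then show "card (?P True) + card (?P False) - 3 \<le> 5" using T_H T_K by linarith
  qed simp
  finally have inner_legs: "card LS.inner_legs \<le> 32" by simp

  have homs: "(card (mod2_homs G L))\<^sup>2 \<le> 128"
  proof -
    let ?h = "card (mod2_homs G L)" and ?c = "card (invariant_sets nodes node_links)"
    have c: "0 < ?c" by (rule card_invariant_sets_pos[OF finite_nodes])
    have "(?h * ?c)\<^sup>2 \<le> (2 * card edge_cochains)\<^sup>2"
      using card_mod2_homs_join by (rule power_mono) simp
    also have "\<dots> = 4 * (card edge_cochains)\<^sup>2" by (simp add: power2_eq_square)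
    also have "\<dots> \<le> 4 * card half_edge_cochains" using card_edge_cochains by simp
    also have "\<dots> \<le> 4 * (?c\<^sup>2 * card LS.inner_legs)" using LS.card_legs_le legs by simp
    also have "\<dots> \<le> 4 * (?c\<^sup>2 * 32)" using inner_legs by simp
    finally have "?c\<^sup>2 * ?h\<^sup>2 \<le> ?c\<^sup>2 * 128" by (simp add: power_mult_distrib mult.commute)
    then show ?thesis using c by simp
  qed

  have sub_carrier: "AH \<subseteq> carrier G" "AK \<subseteq> carrier G"
    using AH(2) AK(2) generate.incl[of _ AH G] generate.incl[of _ AK G]
      subgroup.subset[OF H] subgroup.subset[OF K] by auto
  have gen_L: "generate G (AH \<union> AK) = L"
  proof
    have "AH \<union> AK \<subseteq> H \<union> K" using AH(2) AK(2) generate.incl[of _ AH G] generate.incl[of _ AK G] by blast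
    then show "generate G (AH \<union> AK) \<subseteq> L" by (rule mono_generate)
    have "H \<union> K \<subseteq> generate G (AH \<union> AK)"
      using AH(2) AK(2) mono_generate[of AH "AH \<union> AK"] mono_generate[of AK "AH \<union> AK"] by auto
    then show "L \<subseteq> generate G (AH \<union> AK)"
      by (rule generate_subgroup_incl) (rule generate_is_subgroup, use sub_carrier in blast)
  qed
  have fin_gen: "finite (AH \<union> AK)" "AH \<union> AK \<subseteq> carrier G" using AH AK sub_carrier by auto
  have fin_L: "finite (half_edges L)" "finite (vertices L)"
    using finite_core[OF fin_gen L gen_L] .
  have fin_EL: "finite (edges L)" by (rule finite_subset[OF edges_subset fin_L(1)])
  obtain A where A: "finite A" "A \<subseteq> L" "generate G A = L" "card A + card (vertices L) \<le> Suc (card (edges L))"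
    using generators_of_core[OF L fin_L(2) fin_EL] by blast
  have pos: "0 < card (vertices L)" using fin_L base_vertex[OF L] by (auto simp: card_gt_0_iff)
  have "(2::nat) ^ card A * 2 ^ (card (vertices L) - 1) \<le> 2 ^ card (edges L)"
    unfolding power_add[symmetric] using A(4) pos by (intro power_increasing) auto
  also have "\<dots> \<le> card (mod2_homs G L) * 2 ^ (card (vertices L) - 1)"
    by (rule card_edges_le_mod2_homs[OF L fin_L(2) fin_EL card_mod2_homs_le(1)[OF L gen_L fin_gen(1)]])
  finally have "2 ^ card A \<le> card (mod2_homs G L)" by simp
  then have "(2 ^ card A)\<^sup>2 \<le> (card (mod2_homs G L))\<^sup>2" by (rule power_mono) simp
  then have "((2::nat) ^ card A)\<^sup>2 \<le> 128" using homs by (rule order_trans)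
  then have "(2::nat) ^ (2 * card A) \<le> 128" by (simp only: power_even_eq)
  also have "(128::nat) = 2 ^ 7" by simp
  finally have "2 * card A \<le> 7" by (simp only: power_increasing_iff)
  then show ?thesis using A by (intro exI[of _ A]) auto
qed

end

lemma (in group) subgroup_rank_le:
  assumes "subgroup H G" and "finite A" "A \<subseteq> H" "generate G A = H"
  shows "subgroup_rank G H \<le> enat (card A)"
  unfolding group_rank_def using assms generate_consistent[OF assms(3,1)]
  by (intro Inf_lower) auto

lemma (in group) subgroup_rank_attained:
  assumes "subgroup H G" and "subgroup_rank G H = enat n"
  obtains A where "finite A" "A \<subseteq> H" "generate G A = H" "card A = n"
proof -
  let ?X = "{enat (card A) |A. finite A \<and> A \<subseteq> H \<and> generate (G\<lparr>carrier := H\<rparr>) A = H}"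
  have eq: "Inf ?X = enat n" using assms(2) by (simp add: group_rank_def)
  have "?X \<noteq> {}"
  proof
    assume "?X = {}"
    then have "enat n = Inf {}" using eq by (simp only:)
    then show False by (simp add: top_enat_def)
  qed
  then obtain k where "k \<in> ?X" by (meson ex_in_conv)
  then have "Inf ?X \<in> ?X" by (rule wellorder_InfI)
  then have "enat n \<in> ?X" unfolding eq .
  then obtain A where A: "enat n = enat (card A) \<and> finite A \<and> A \<subseteq> H \<and> generate (G\<lparr>carrier := H\<rparr>) A = H"
    unfolding mem_Collect_eq by (elim exE)
  then have "generate G A = H" using generate_consistent[OF _ assms(1), of A] by simp
  then show ?thesis using that[of A] A by simp
qed

theorem corollary6p5:
  fixes G :: "('a, 'b) monoid_scheme" and H K :: "'a set"
  assumes "free_group G"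
    and "subgroup H G" and "subgroup K G"
    and "subgroup_rank G H = 3" and "subgroup_rank G K = 3"
    and "subgroup_rank G (H \<inter> K) \<ge> 3"
  shows "subgroup_rank G (subgroup_join G H K) \<le> 3"
proof -
  interpret group G using assms(1) by (simp add: free_group_def)
  note H = assms(2) and K = assms(3)
  obtain S where S: "free_basis G S" using assms(1) by (auto simp: free_group_def)
  interpret E: free_evaluation G S "letter_value G"
  proof
    show "letter_value G d \<in> carrier G" if "fst d \<in> S" for d
      using that S by (auto simp: free_basis_def letter_value_def)
    show "letter_value G (flip d) = inv\<^bsub>G\<^esub> letter_value G d" if "fst d \<in> S" for d
      using that S by (auto simp: free_basis_def letter_value_def)
    show "bij_betw (\<lambda>w. foldr (\<lambda>d g. letter_value G d \<otimes>\<^bsub>G\<^esub> g) w \<one>\<^bsub>G\<^esub>) (reduced_words S) (carrier G)"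
      using S by (simp add: free_basis_def word_value_def[abs_def])
  qed
  have M: "subgroup (H \<inter> K) G" by (rule subgroups_Inter_pair[OF H K])
  have three: "3 \<le> card A" if "finite A" "A \<subseteq> H \<inter> K" "generate G A = H \<inter> K" for A
    using order.trans[OF assms(6) subgroup_rank_le[OF M that]] by (simp add: numeral_eq_enat)
  obtain AH where AH: "finite AH" "AH \<subseteq> H" "generate G AH = H" "card AH = 3"
    using subgroup_rank_attained[OF H, of 3] assms(4) by (auto simp: numeral_eq_enat)
  obtain AK where AK: "finite AK" "AK \<subseteq> K" "generate G AK = K" "card AK = 3"
    using subgroup_rank_attained[OF K, of 3] assms(5) by (auto simp: numeral_eq_enat)
  \<comment> \<open>The trivial group needs no generators, so the intersection is not trivial.\<close>
  obtain m where m: "m \<in> H \<inter> K" "m \<noteq> \<one>\<^bsub>G\<^esub>"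
  proof (rule ccontr)
    assume "\<not> thesis"
    then have "H \<inter> K = {\<one>\<^bsub>G\<^esub>}" using that subgroup.one_closed[OF M] by blast
    then show False using three[of "{}"] generate_empty by simp
  qed
  have mc: "m \<in> carrier G" by (rule subgroup.mem_carrier[OF M m(1)])
  have "E.nf m \<noteq> []" using E.wv_nf[OF mc] m(2) by auto
  then obtain u c where uc: "E.nf m = u @ c @ word_inverse u" "cyclically_reduced c"
    using cyclic_reduction[OF E.nf_reduced[OF mc]] by blast
  have on_S: "E.on_S u" "E.on_S c" using E.nf_on_S[OF mc] uc(1) by auto
  have c_red: "c \<in> reduced_words S" using E.nf_reduced[OF mc] uc(1) by (simp add: reduced_words_append_iff)
  \<comment> \<open>After moving the base point to \<open>u\<close>, the word of \<open>m\<close> is its cyclically reduced core \<open>c\<close>.\<close>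
  let ?u = "E.wv u"
  have u: "?u \<in> carrier G" using on_S by simp
  let ?lv = "\<lambda>d. ?u \<otimes>\<^bsub>G\<^esub> letter_value G d \<otimes>\<^bsub>G\<^esub> inv\<^bsub>G\<^esub> ?u"
  interpret C: free_evaluation G S ?lv by (rule E.conjugate_evaluation(1)[OF u])
  have "m = ?u \<otimes>\<^bsub>G\<^esub> (E.wv c \<otimes>\<^bsub>G\<^esub> inv\<^bsub>G\<^esub> ?u)"
    using E.wv_nf[OF mc] uc(1) on_S by (simp add: E.wv_append E.wv_word_inverse image_Un)
  also have "\<dots> = C.wv c"
    using E.conjugate_evaluation(2)[OF u on_S(2)] on_S u by (simp add: C.wv_def m_assoc)
  finally have "C.nf m = c" using C.nf_wv[OF c_red] by simp
  then have cyc: "cyclically_reduced (C.nf m)" using uc(2) by simp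
  have AHc: "AH \<subseteq> carrier G" and AKc: "AK \<subseteq> carrier G"
    using AH(2) AK(2) subgroup.subset[OF H] subgroup.subset[OF K] by auto
  interpret P: subgroup_pair G S ?lv H K m
    using C.finite_core[OF AH(1) AHc H AH(3)] C.finite_core[OF AK(1) AKc K AK(3)] H K m(1) cyc
    by (intro subgroup_pair.intro subgroup_pair_axioms.intro C.free_evaluation_axioms) simp_all
  have "\<exists>A. finite A \<and> A \<subseteq> generate G (H \<union> K) \<and> generate G A = generate G (H \<union> K) \<and> card A \<le> 3"
    by (rule P.rank_join_le_3[OF AH(1,3) _ AK(1,3) _ three]) (simp_all add: AH(4) AK(4))
  then obtain A where A: "finite A" "A \<subseteq> generate G (H \<union> K)" "generate G A = generate G (H \<union> K)" "card A \<le> 3"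
    by (elim exE conjE)
  have "subgroup_rank G (subgroup_join G H K) \<le> enat (card A)"
    unfolding subgroup_join_def by (rule subgroup_rank_le[OF P.L A(1-3)])
  also have "\<dots> \<le> 3" using A(4) by (simp add: numeral_eq_enat)
  finally show ?thesis .
qed

end
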